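(* Let $P$ be a $d$-dimensional reflexive polytope. - If $d=2$: $P$ is a CL-polytope if and only if $\operatorname{vol}(P)\leq 4$, or equivalently if and only if $|P\cap\mathbb{Z}^2|\leq 9$. - If $d=3$: $P$ is a CL-polytope if and only if $\operatorname{vol}(P)\leq 8$, or equivalently if and only if $|P\cap\mathbb{Z}^3|\leq 27$. - If $d=4$: $P$ is a CL-polytope if and only if either $\operatorname{vol}(P)=16$ and $|P\cap\mathbb{Z}^4|=81$, or all three of the following hold: $$5\operatorname{vol}(P)<|P\cap\mathbb{Z}^4|-1,\qquad 2|P\cap\mathbb{Z}^4|\leq 9(\operatorname{vol}(P)+2),\qquad \left(|P\cap\mathbb{Z}^4|-1-4\operatorname{vol}(P)\right)^2\geq 16\operatorname{vol}(P).$$ - If $d=5$: $P$ is a CL-polytope if and only if either $\operatorname{vol}(P)=32$ and $|P\cap\mathbb{Z}^5|=243$, or all three of the following hold: $$15\operatorname{vol}(P)<2\left(|P\cap\mathbb{Z}^5|-3\right),\qquad 4|P\cap\mathbb{Z}^5|\leq 27(\operatorname{vol}(P)+4),\qquad \left(|P\cap\mathbb{Z}^5|-3-6\operatorname{vol}(P)\right)^2\geq 72\operatorname{vol}(P).$$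
   Context: A $d$-dimensional lattice polytope is a full-dimensional convex polytope $P\subset\mathbb{Z}^d\otimes_{\mathbb{Z}}\mathbb{Q}$ with vertices in $\mathbb{Z}^d$. It is reflexive if its dual $P^*:=\{u\in\mathbb{Z}^d\otimes_{\mathbb{Z}}\mathbb{Q}\mid\langle u,v\rangle\geq -1\text{ for all }v\in P\}$ is also a lattice polytope. $\operatorname{vol}(P)$ denotes the usual (non-normalised) Euclidean volume. The Ehrhart polynomial $L_P$ is the degree-$d$ polynomial with $L_P(m)=|mP\cap\mathbb{Z}^d|$ for all integers $m\geq 0$, regarded as a polynomial over $\mathbb{C}$. $P$ is a CL-polytope if every root $z\in\mathbb{C}$ of $L_P$ satisfies $\operatorname{Re}(z)=-1/2$. *)

theory Defs
  imports "HOL-Analysis.Analysis" "HOL-Computational_Algebra.Polynomial"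
begin

(* The ambient space is R^d, with d = CARD('n). A lattice polytope in Q^d and the real
   polytope with the same vertices determine each other, and they have the same lattice
   points in every dilate and, dually, the same lattice vertices. *)

definition lattice_points :: "(real ^ 'n) set" where
  "lattice_points = {x. \<forall>i. x $ i \<in> \<int>}"

definition lattice_polytope :: "(real ^ 'n) set \<Rightarrow> bool" where
  "lattice_polytope P \<longleftrightarrow>
     polytope P \<and> aff_dim P = int CARD('n) \<and>
     (\<forall>v. v extreme_point_of P \<longrightarrow> v \<in> lattice_points)"

definition dual_polytope :: "(real ^ 'n) set \<Rightarrow> (real ^ 'n) set" where
  "dual_polytope P = {u. \<forall>v\<in>P. u \<bullet> v \<ge> -1}"

definition reflexive_polytope :: "(real ^ 'n) set \<Rightarrow> bool" where
  "reflexive_polytope P \<longleftrightarrow> lattice_polytope P \<and> lattice_polytope (dual_polytope P)"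

definition num_lattice_points :: "(real ^ 'n) set \<Rightarrow> nat" where
  "num_lattice_points P = card (P \<inter> lattice_points)"

(* Existence, for lattice polytopes, is Ehrhart's theorem; uniqueness is immediate, since a
   polynomial is determined by its values at the natural numbers. *)
definition ehrhart_polynomial :: "(real ^ 'n) set \<Rightarrow> complex poly" where
  "ehrhart_polynomial P =
     (THE L. degree L = CARD('n) \<and>
        (\<forall>m::nat. poly L (of_nat m) = of_nat (num_lattice_points ((*\<^sub>R) (real m) ` P))))"

definition CL_polytope :: "(real ^ 'n) set \<Rightarrow> bool" where
  "CL_polytope P \<longleftrightarrow> (\<forall>z. poly (ehrhart_polynomial P) z = 0 \<longrightarrow> Re z = - 1 / 2)"

end

theory Submission
  imports Defs
begin

text \<open>For a reflexive \<open>P\<close> the gauge of \<open>P\<close> is integral on the lattice, and it is linear on the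
  simplicial cones of a triangulated fan over the boundary. Shifting by a generic vector \<open>w\<close> makes
  these cones half-open and disjoint, and each of them contributes
  \<open>(m + d - h choose d)\<close> for every lattice point of height \<open>h\<close> in its fundamental box; this gives
  the Ehrhart polynomial \<open>L\<close>. Replacing \<open>w\<close> by \<open>- w\<close> reflects each box and exchanges \<open>h\<close> with
  \<open>d - h\<close>, so that \<open>L (- 1 - z) = (- 1) ^ d * L z\<close>. Hence \<open>L\<close> is a polynomial in \<open>t = z * (z + 1)\<close>,
  times \<open>2 * z + 1\<close> for odd \<open>d\<close>, whose coefficients for \<open>d \<le> 5\<close> are determined by the volume
  (the leading coefficient of \<open>L\<close>) and by \<open>L 1\<close>. The line \<open>Re z = - 1 / 2\<close> corresponds to real
  \<open>t \<le> - 1 / 4\<close>.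

  No triangulation is constructed: its cones are the optimal bases of the linear program that
  writes a point as a conical combination of the vertices with generic costs close to \<open>1\<close>.\<close>

subsection \<open>Optimal bases\<close>

definition bases :: "'a::euclidean_space set \<Rightarrow> 'a set set" where
  "bases V = {B. B \<subseteq> V \<and> independent B \<and> span B = UNIV}"

text \<open>The linear functional that takes the value \<open>c b\<close> at each \<open>b \<in> B\<close>.\<close>

definition weight :: "('a::euclidean_space \<Rightarrow> real) \<Rightarrow> 'a set \<Rightarrow> 'a \<Rightarrow> real" where
  "weight c B x = (\<Sum>b\<in>B. representation B x b * c b)"

text \<open>Dual feasibility in the linear program: the functional that prices \<open>B\<close>
  exactly charges no vector of \<open>V\<close> more than its cost. For constant cost 1,
  \<open>B\<close> lies on a supporting hyperplane of the convex hull of \<open>V\<close>.\<close>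

definition optimal_bases :: "('a::euclidean_space \<Rightarrow> real) \<Rightarrow> 'a set \<Rightarrow> 'a set set" where
  "optimal_bases c V = {B \<in> bases V. \<forall>v\<in>V. weight c B v \<le> c v}"

lemma basesD:
  fixes B :: "'a::euclidean_space set"
  assumes "B \<in> bases V"
  shows "B \<subseteq> V" "independent B" "span B = UNIV" "finite B" "card B = DIM('a)"
proof -
  show *: "B \<subseteq> V" "independent B" "span B = UNIV"
    using assms by (auto simp: bases_def)
  show "finite B" using *(2) by (rule independent_imp_finite)
  have "card B = dim B" using dim_eq_card_independent[OF *(2)] by (rule sym)
  also have "\<dots> = dim (span B)" by (rule dim_span[symmetric])
  also have "\<dots> = DIM('a)" unfolding *(3) by (rule dim_UNIV)
  finally show "card B = DIM('a)" .
qed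

section \<open>Coordinates and weights in a basis\<close>

lemma
  assumes "B \<in> bases V"
  shows representation_add_bases: "representation B (x + y) b = representation B x b + representation B y b"
    and representation_diff_bases: "representation B (x - y) b = representation B x b - representation B y b"
    and representation_scale_bases: "representation B (r *\<^sub>R x) b = r * representation B x b"
    and representation_uminus_bases: "representation B (- x) b = - representation B x b"
    and representation_sum_bases: "representation B (\<Sum>i\<in>I. f i) b = (\<Sum>i\<in>I. representation B (f i) b)"
    and representation_base_bases: "b' \<in> B \<Longrightarrow> representation B b' b = (if b = b' then 1 else 0)"
    and sum_representation_bases: "(\<Sum>b\<in>B. representation B x b *\<^sub>R b) = x"
  using basesD[OF assms]
  by (simp_all add: real_vector.representation_add real_vector.representation_diff
      real_vector.representation_scale real_vector.representation_neg real_vector.representation_sum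
      real_vector.representation_basis real_vector.sum_representation_eq)

lemma representation_eqI_bases:
  assumes "B \<in> bases V" "(\<Sum>b\<in>B. f b *\<^sub>R b) = x" "b \<in> B"
  shows "representation B x b = f b"
proof -
  have "representation B x b = (\<Sum>b'\<in>B. representation B (f b' *\<^sub>R b') b)"
    unfolding assms(2)[symmetric] by (rule representation_sum_bases[OF assms(1)])
  also have "\<dots> = (\<Sum>b'\<in>B. if b' = b then f b else 0)"
    by (rule sum.cong)
      (auto simp: representation_scale_bases[OF assms(1)] representation_base_bases[OF assms(1)])
  finally show ?thesis using assms basesD[OF assms(1)] by simp
qed

lemma
  assumes "B \<in> bases V"
  shows weight_add: "weight c B (x + y) = weight c B x + weight c B y"
    and weight_diff: "weight c B (x - y) = weight c B x - weight c B y"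
    and weight_scale: "weight c B (r *\<^sub>R x) = r * weight c B x"
    and weight_base: "b \<in> B \<Longrightarrow> weight c B b = c b"
  using basesD(4)[OF assms]
  by (simp_all add: weight_def representation_add_bases[OF assms] representation_diff_bases[OF assms]
    representation_scale_bases[OF assms] representation_base_bases[OF assms] algebra_simps
    sum.distrib sum_subtractf sum_distrib_left if_distrib[of "\<lambda>x. c b * x" for b] cong: if_cong)

lemma linear_weight:
  assumes "B \<in> bases V"
  shows "linear (weight c B)"
  by (rule linearI) (simp_all add: weight_add[OF assms] weight_scale[OF assms])

lemma weight_eqI:
  assumes "B \<in> bases V" "linear f" "\<And>b. b \<in> B \<Longrightarrow> f b = c b"
  shows "f x = weight c B x"
proof -
  have "f x = f (\<Sum>b\<in>B. representation B x b *\<^sub>R b)"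
    by (simp add: sum_representation_bases[OF assms(1)])
  also have "\<dots> = (\<Sum>b\<in>B. representation B x b * f b)"
    by (simp add: linear_sum[OF assms(2)] linear_cmul[OF assms(2)])
  also have "\<dots> = weight c B x"
    unfolding weight_def using assms(3) by simp
  finally show ?thesis .
qed

section \<open>Comparison of optimal bases\<close>

lemma weight_change_basis:
  assumes "B \<in> bases V" "B' \<in> bases V"
  shows "weight c B x = (\<Sum>b\<in>B'. representation B' x b * weight c B b)"
proof -
  have "weight c B x = weight (weight c B) B' x"
    by (rule weight_eqI[OF assms(2) linear_weight[OF assms(1)]]) (rule refl)
  then show ?thesis unfolding weight_def[of "weight c B" B'] .
qed

text \<open>Weak duality: in the expansion of \<open>x\<close> over \<open>B'\<close> with
  nonnegative coordinates, the functional of \<open>B\<close> is at most \<open>c\<close> at each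
  element of \<open>B'\<close>.\<close>

lemma weight_optimal_le:
  assumes "B \<in> optimal_bases c V" "B' \<in> bases V" "\<And>b. b \<in> B' \<Longrightarrow> representation B' x b \<ge> 0"
  shows "weight c B x \<le> weight c B' x"
proof -
  have B: "B \<in> bases V" using assms(1) by (simp add: optimal_bases_def)
  have "weight c B x = (\<Sum>b\<in>B'. representation B' x b * weight c B b)"
    by (rule weight_change_basis[OF B assms(2)])
  also have "\<dots> \<le> weight c B' x"
    unfolding weight_def[of c B' x]
    using assms basesD(1)[OF assms(2)]
    by (intro sum_mono mult_left_mono) (auto simp: optimal_bases_def)
  finally show ?thesis .
qed

text \<open>At some \<open>v\<close> in \<open>B'\<close> outside \<open>B\<close> the dual
  inequality would be strict by genericity. The positive coordinate of \<open>x\<close> at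
  \<open>v\<close> then makes weak duality strict, against weak duality with the bases
  exchanged.\<close>

lemma optimal_bases_subset:
  assumes "B \<in> optimal_bases c V" "B' \<in> optimal_bases c V"
    and generic: "\<And>v. v \<in> V - B \<Longrightarrow> weight c B v \<noteq> c v"
    and pos: "\<And>b. b \<in> B \<Longrightarrow> representation B x b > 0" "\<And>b. b \<in> B' \<Longrightarrow> representation B' x b > 0"
  shows "B' \<subseteq> B"
proof (rule ccontr)
  assume "\<not> B' \<subseteq> B"
  then obtain v where v: "v \<in> B'" "v \<notin> B" by blast
  have B: "B \<in> bases V" "B' \<in> bases V" using assms by (auto simp: optimal_bases_def)
  have "weight c B x = (\<Sum>b\<in>B'. representation B' x b * weight c B b)"
    by (rule weight_change_basis[OF B])
  also have "\<dots> < weight c B' x"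
    unfolding weight_def[of c B' x]
  proof (rule sum_strict_mono_ex1)
    show "finite B'" by (rule basesD(4)[OF B(2)])
    have le: "weight c B b \<le> c b" if "b \<in> B'" for b
      using that assms(1) basesD(1)[OF B(2)] by (auto simp: optimal_bases_def)
    show "\<forall>b\<in>B'. representation B' x b * weight c B b \<le> representation B' x b * c b"
      using le pos(2) by (auto intro!: mult_left_mono less_imp_le)
    have "weight c B v < c v"
      using le[OF v(1)] generic[of v] v basesD(1)[OF B(2)] by force
    then show "\<exists>b\<in>B'. representation B' x b * weight c B b < representation B' x b * c b"
      using v pos(2) by (intro bexI[of _ v]) (auto intro!: mult_strict_left_mono)
  qed
  finally have "weight c B x < weight c B' x" .
  moreover have "weight c B' x \<le> weight c B x"
    by (rule weight_optimal_le[OF assms(2) B(1)]) (use pos in \<open>force intro: less_imp_le\<close>)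
  ultimately show False by simp
qed

lemma optimal_bases_unique:
  assumes "B \<in> optimal_bases c V" "B' \<in> optimal_bases c V"
    and generic: "\<And>B v. B \<in> bases V \<Longrightarrow> v \<in> V - B \<Longrightarrow> weight c B v \<noteq> c v"
    and pos: "\<And>b. b \<in> B \<Longrightarrow> representation B x b > 0" "\<And>b. b \<in> B' \<Longrightarrow> representation B' x b > 0"
  shows "B = B'"
  using optimal_bases_subset[OF assms(1,2) _ pos] optimal_bases_subset[OF assms(2,1) _ pos(2,1)]
    assms(1,2) generic unfolding optimal_bases_def by blast

section \<open>Generic costs and generic directions\<close>

lemma finite_bases: "finite V \<Longrightarrow> finite (bases V)"
  by (rule finite_subset[of _ "Pow V"]) (auto simp: bases_def)

lemma eventually_notin_finite_at_right:
  fixes F :: "real set"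
  assumes "finite F"
  shows "eventually (\<lambda>s. s \<notin> F) (at_right a)"
proof -
  have "eventually (\<lambda>s. s \<notin> F) (at a)"
    using islimpt_finite[OF assms] islimpt_iff_eventually by blast
  then show ?thesis by (simp add: eventually_at_split)
qed

text \<open>The second property excludes ties; the third keeps optimality for the unperturbed cost,
  so that in the application each cone lies over a single facet. The finitely many conditions all
  hold for small \<open>s > 0\<close>.\<close>

lemma exists_generic_cost:
  fixes V :: "'a::euclidean_space set"
  assumes "finite V"
  obtains c where "\<And>v. v \<in> V \<Longrightarrow> 1 \<le> c v \<and> c v \<le> 2"
    and "\<And>B v. B \<in> bases V \<Longrightarrow> v \<in> V - B \<Longrightarrow> weight c B v \<noteq> c v"
    and "optimal_bases c V \<subseteq> optimal_bases (\<lambda>_. 1) V"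
proof -
  obtain e :: "'a \<Rightarrow> nat" where e: "inj_on e V"
    using finite_imp_inj_to_nat_seg[OF assms] by blast
  \<comment> \<open>Distinct powers of \<open>s\<close> make every bad event a root of a nonzero polynomial in \<open>s\<close>.\<close>
  define c where "c = (\<lambda>(s::real) v. 1 + s ^ Suc (e v))"
  have "eventually (\<lambda>s::real. 0 < s \<and> s < 1) (at_right 0)"
    by (auto simp: eventually_at_right_field intro!: exI[of _ 1])
  then have E1: "eventually (\<lambda>s. \<forall>v\<in>V. 1 \<le> c s v \<and> c s v \<le> 2) (at_right 0)"
    by eventually_elim (auto simp: c_def simp del: power_Suc intro!: power_le_one)
  have "eventually (\<lambda>s. weight (c s) B v \<noteq> c s v) (at_right 0)" if B: "B \<in> bases V" and v: "v \<in> V - B" for B v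
  proof -
    define q where "q = (\<Sum>b\<in>B. smult (representation B v b) (1 + monom 1 (Suc (e b)))) - (1 + monom 1 (Suc (e v)))"
    have q: "poly q s = weight (c s) B v - c s v" for s
      by (simp add: q_def weight_def c_def poly_sum poly_monom)
    \<comment> \<open>Injectivity of \<open>e\<close> keeps the exponent of \<open>v\<close> apart
      from those of \<open>B\<close>.\<close>
    have "coeff q (Suc (e v)) = - 1"
    proof -
      have "e b \<noteq> e v" if "b \<in> B" for b
        using that v e basesD(1)[OF B] by (metis DiffD1 DiffD2 inj_on_eq_iff subsetD)
      then show ?thesis
        by (simp add: q_def coeff_sum)
    qed
    then have "q \<noteq> 0" by auto
    then have "finite {s. poly q s = 0}" by (rule poly_roots_finite)
    from eventually_notin_finite_at_right[OF this, of 0] show ?thesis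
      by (simp add: q)
  qed
  then have E2: "eventually (\<lambda>s. \<forall>B\<in>bases V. \<forall>v\<in>V-B. weight (c s) B v \<noteq> c s v) (at_right 0)"
    using assms finite_bases[OF assms] by (intro eventually_ball_finite ballI) auto
  \<comment> \<open>A constraint violated at cost 1 stays violated at nearby costs; the
    contrapositive is the inclusion of optimal bases.\<close>
  have "eventually (\<lambda>s. weight (\<lambda>_. 1) B v > 1 \<longrightarrow> weight (c s) B v > c s v) (at_right 0)"
    if B: "B \<in> bases V" for B v
  proof (cases "weight (\<lambda>_. 1) B v > 1")
    case True
    have *: "((\<lambda>s::real. s ^ Suc (e v)) \<longlongrightarrow> 0) (at_right 0)" for v
      by (auto intro!: tendsto_eq_intros)
    have "((\<lambda>s. weight (c s) B v - c s v) \<longlongrightarrow> weight (\<lambda>_. 1) B v - 1) (at_right 0)"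
      unfolding weight_def c_def by (auto intro!: tendsto_eq_intros *)
    from order_tendstoD(1)[OF this, of 0] True show ?thesis by simp
  qed simp
  then have E3: "eventually (\<lambda>s. \<forall>B\<in>bases V. \<forall>v\<in>V. weight (\<lambda>_. 1) B v > 1 \<longrightarrow> weight (c s) B v > c s v) (at_right 0)"
    using assms finite_bases[OF assms] by (intro eventually_ball_finite ballI) auto
  have "\<exists>s. (\<forall>v\<in>V. 1 \<le> c s v \<and> c s v \<le> 2) \<and> (\<forall>B\<in>bases V. \<forall>v\<in>V-B. weight (c s) B v \<noteq> c s v) \<and>
      (\<forall>B\<in>bases V. \<forall>v\<in>V. weight (\<lambda>_. 1) B v > 1 \<longrightarrow> weight (c s) B v > c s v)"
    by (rule eventually_happens'[OF trivial_limit_at_right_real eventually_conj[OF E1 eventually_conj[OF E2 E3]]])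
  then obtain s where s: "\<forall>v\<in>V. 1 \<le> c s v \<and> c s v \<le> 2"
    "\<forall>B\<in>bases V. \<forall>v\<in>V-B. weight (c s) B v \<noteq> c s v"
    "\<forall>B\<in>bases V. \<forall>v\<in>V. weight (\<lambda>_. 1) B v > 1 \<longrightarrow> weight (c s) B v > c s v"
    by blast
  show ?thesis
  proof (rule that[of "c s"])
    show "optimal_bases (c s) V \<subseteq> optimal_bases (\<lambda>_. 1) V"
      using s(3) by (auto simp: optimal_bases_def) (meson leD leI)
  qed (use s in auto)
qed

text \<open>The walls of a cone over a basis lie in spans of proper subsets of that basis, so a
  generic point is on no wall. The case \<open>S = {}\<close> excludes the origin.\<close>

definition generic :: "'a::euclidean_space set \<Rightarrow> 'a \<Rightarrow> bool" where
  "generic V y \<longleftrightarrow> (\<forall>S\<subseteq>V. span S \<noteq> UNIV \<longrightarrow> y \<notin> span S)"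

text \<open>Finitely many proper subspaces, each of measure zero, do not cover the space.\<close>

lemma exists_generic:
  fixes V :: "'a::euclidean_space set"
  assumes "finite V"
  obtains w where "generic V w"
proof -
  have "negligible (\<Union>S\<in>{S. S \<subseteq> V \<and> span S \<noteq> UNIV}. span S)"
  proof (rule negligible_Union)
    show "finite (span ` {S. S \<subseteq> V \<and> span S \<noteq> UNIV})"
      using assms by simp
    show "negligible T" if T: "T \<in> span ` {S. S \<subseteq> V \<and> span S \<noteq> UNIV}" for T
    proof -
      obtain S where S: "T = span S" "span S \<noteq> UNIV" using T by blast
      have "dim S \<noteq> DIM('a)" using S(2) by (simp add: dim_eq_full)
      then have "dim T < DIM('a)"
        using dim_subset_UNIV[of S] S(1) by simp
      then show ?thesis by (rule negligible_lowdim)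
    qed
  qed
  then have "(\<Union>S\<in>{S. S \<subseteq> V \<and> span S \<noteq> UNIV}. span S) \<noteq> UNIV"
    using non_negligible_UNIV by metis
  then obtain w where "w \<notin> (\<Union>S\<in>{S. S \<subseteq> V \<and> span S \<noteq> UNIV}. span S)" by blast
  then have "generic V w" by (auto simp: generic_def)
  then show ?thesis by (rule that)
qed

text \<open>A vanishing coordinate would put \<open>w\<close> into the span of
  \<open>B - {b}\<close>, which is proper by independence.\<close>

lemma generic_representation_ne_0:
  assumes "generic V w" "B \<in> bases V" "b \<in> B"
  shows "representation B w b \<noteq> 0"
proof
  assume 0: "representation B w b = 0"
  note B = basesD[OF assms(2)]
  have "b \<notin> span (B - {b})"
    using B(2) assms(3) by (auto simp: dependent_def)
  then have "w \<notin> span (B - {b})"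
    using assms(1) B(1) unfolding generic_def by blast
  moreover have "w = (\<Sum>b\<in>B - {b}. representation B w b *\<^sub>R b)"
    using sum_representation_bases[OF assms(2), of w] 0 B(4) assms(3)
    by (simp add: sum.remove[of B b])
  then have "w \<in> span (B - {b})"
    by (metis (no_types, lifting) span_base span_scale span_sum)
  ultimately show False by contradiction
qed

text \<open>Linear programming duality for minimising the total cost of a conical combination of
  \<open>V\<close> representing \<open>y\<close>: the dual solution is a supporting hyperplane.\<close>

lemma optimal_bases_cover:
  fixes V :: "'a::euclidean_space set"
  assumes fin: "finite V" and int: "0 \<in> interior (convex hull V)"
    and c: "\<And>v. v \<in> V \<Longrightarrow> 1 \<le> c v \<and> c v \<le> 2"
    and gen: "\<And>B v. B \<in> bases V \<Longrightarrow> v \<in> V - B \<Longrightarrow> weight c B v \<noteq> c v"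
    and y: "generic V y"
  obtains B where "B \<in> optimal_bases c V" "\<And>b. b \<in> B \<Longrightarrow> representation B y b \<ge> 0"
proof -
  \<comment> \<open>Rescaling to unit cost makes the minimal cost of \<open>y\<close> its gauge with
    respect to \<open>K\<close>; the optimum is found where the ray through \<open>y\<close> leaves
    \<open>K\<close>. Including 0 lets points of \<open>K\<close> shrink towards the origin.\<close>
  define g where "g = (\<lambda>v. (1 / c v) *\<^sub>R v)"
  define W where "W = insert 0 (g ` V)"
  define K where "K = convex hull W"
  have finW: "finite W" using fin by (simp add: W_def)
  have K: "convex K" "compact K"
    using finW by (simp_all add: K_def finite_imp_compact_convex_hull)
  have gK: "g v \<in> K" if "v \<in> V" for v
    using that by (auto simp: K_def W_def intro: hull_inc)
  have 0: "0 \<in> K" by (auto simp: K_def W_def intro: hull_inc)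
  have half: "(1/2) *\<^sub>R x \<in> K" if "x \<in> convex hull V" for x
  proof -
    have "(1/2) *\<^sub>R v \<in> K" if v: "v \<in> V" for v
    proof -
      have "(c v / 2) *\<^sub>R g v + (1 - c v / 2) *\<^sub>R 0 \<in> K"
        using c[OF v] by (intro convexD[OF K(1) gK[OF v] 0]) auto
      then show ?thesis using c[OF v] by (simp add: g_def)
    qed
    then have "convex hull ((*\<^sub>R) (1/2) ` V) \<subseteq> K"
      using K(1) by (intro hull_minimal) auto
    then show ?thesis using that convex_hull_scaling[of "1/2" V] by auto
  qed
  \<comment> \<open>Costs of at most 2 leave half of the convex hull of \<open>V\<close>, and hence
    a ball around the origin, inside \<open>K\<close>.\<close>
  have intK: "0 \<in> interior K"
  proof -
    obtain r where r: "r > 0" "ball 0 r \<subseteq> convex hull V"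
      using int by (auto simp: mem_interior)
    have "ball 0 (r/2) \<subseteq> K"
    proof
      fix z :: 'a assume "z \<in> ball 0 (r/2)"
      then have "2 *\<^sub>R z \<in> convex hull V" using r by (intro subsetD[OF r(2)]) auto
      from half[OF this] show "z \<in> K" by simp
    qed
    then show ?thesis using r by (auto simp: mem_interior intro!: exI[of _ "r/2"])
  qed
  have "span {} \<noteq> (UNIV :: 'a set)"
    by (metis dim_UNIV dim_span dim_empty DIM_positive less_irrefl)
  then have "y \<notin> span {}" using y unfolding generic_def by blast
  then have "y \<noteq> 0" by auto
  from ray_to_frontier[OF compact_imp_bounded[OF K(2)] intK this]
  obtain d where d: "d > 0" "d *\<^sub>R y \<in> frontier K" by auto
  have dyK: "d *\<^sub>R y \<in> K" "d *\<^sub>R y \<notin> interior K"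
    using d(2) compact_imp_closed[OF K(2)] by (auto simp: frontier_def)
  have rel: "rel_interior K = interior K"
    using intK by (intro rel_interior_nonempty_interior) auto
  obtain a where a: "\<And>z. z \<in> K \<Longrightarrow> a \<bullet> (d *\<^sub>R y) \<le> a \<bullet> z" "a \<bullet> (d *\<^sub>R y) < a \<bullet> 0"
    using supporting_hyperplane_rel_boundary[OF K(1) dyK(1)] dyK(2) intK unfolding rel by metis
  define t where "t = a \<bullet> (d *\<^sub>R y)"
  have t: "t < 0" using a(2) by (simp add: t_def)
  \<comment> \<open>Division by the negative \<open>t\<close> normalises the supporting functional
    to be at most 1 on \<open>K\<close>, with value 1 at the exit point.\<close>
  define f where "f = (\<lambda>z. (a \<bullet> z) / t)"
  have f: "linear f" unfolding f_def by (rule linearI) (simp_all add: inner_add_right add_divide_distrib)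
  have f1: "f z \<le> 1" if "z \<in> K" for z
  proof -
    have "t \<le> a \<bullet> z" using a(1)[OF that] by (simp only: t_def)
    then show ?thesis using t by (simp add: f_def divide_simps)
  qed
  have fdy: "f (d *\<^sub>R y) = 1" using t unfolding f_def t_def[symmetric] by simp
  have fg: "f (g v) = f v / c v" for v by (simp add: g_def linear_cmul[OF f])
  have fc: "f v \<le> c v" if "v \<in> V" for v
    using f1[OF gK[OF that]] c[OF that] by (simp add: fg divide_simps split: if_splits)
  obtain u where u: "\<And>z. z \<in> W \<Longrightarrow> 0 \<le> u z" "sum u W = 1" "(\<Sum>z\<in>W. u z *\<^sub>R z) = d *\<^sub>R y"
    using dyK(1) unfolding K_def convex_hull_finite[OF finW] by blast
  have WK: "z \<in> W \<Longrightarrow> z \<in> K" for z by (simp add: K_def hull_inc)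
  \<comment> \<open>Complementary slackness: nonnegative slacks average to zero at the exit point,
    so only points with \<open>f z = 1\<close> carry weight.\<close>
  have "(\<Sum>z\<in>W. u z * (1 - f z)) = sum u W - f (\<Sum>z\<in>W. u z *\<^sub>R z)"
    by (simp add: linear_sum[OF f] linear_cmul[OF f] algebra_simps sum_subtractf)
  also have "\<dots> = 0" by (simp only: u fdy diff_self)
  finally have slack: "u z * (1 - f z) = 0" if "z \<in> W" for z
    using that sum_nonneg_eq_0_iff[OF finW, of "\<lambda>z. u z * (1 - f z)"] u(1) f1[OF WK] by force
  define I where "I = {v\<in>V. f v = c v}"
  have tight: "\<exists>v\<in>I. z = g v" if z: "z \<in> W" "u z \<noteq> 0" for z
  proof -
    have "f z = 1" using slack[OF z(1)] z(2) by simp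
    then have "z \<noteq> 0" using linear_0[OF f] by auto
    then obtain v where v: "v \<in> V" "z = g v" using z(1) by (auto simp: W_def)
    then have "f v = c v" using \<open>f z = 1\<close> fg[of v] c[of v] by (auto simp: divide_simps split: if_splits)
    then show ?thesis using v by (auto simp: I_def)
  qed
  have "d *\<^sub>R y \<in> span I"
    unfolding u(3)[symmetric]
  proof (rule span_sum)
    fix z assume z: "z \<in> W"
    show "u z *\<^sub>R z \<in> span I"
    proof (cases "u z = 0")
      case False
      then obtain v where "v \<in> I" "z = g v" using tight[OF z] by blast
      then show ?thesis unfolding g_def by (metis span_base span_scale)
    qed (simp add: span_zero)
  qed
  then have "(1/d) *\<^sub>R (d *\<^sub>R y) \<in> span I" by (rule span_scale)
  then have "y \<in> span I" using d by simp
  moreover have "I \<subseteq> V" by (auto simp: I_def)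
  \<comment> \<open>A generic point lies in no proper span, so the tight vectors span the
    space.\<close>
  ultimately have spanI: "span I = UNIV"
    using y unfolding generic_def by blast
  obtain B where B: "B \<subseteq> I" "independent B" "I \<subseteq> span B"
    using maximal_independent_subset by blast
  have BV: "B \<in> bases V"
    using B spanI span_minimal[OF B(3) subspace_span] by (auto simp: bases_def I_def)
  have fw: "f x = weight c B x" for x
    by (rule weight_eqI[OF BV f]) (use B in \<open>auto simp: I_def\<close>)
  \<comment> \<open>A tight vector outside \<open>B\<close> would be a tie, excluded by
    \<open>gen\<close>. So \<open>B\<close> is all of \<open>I\<close>, and the weights
    \<open>u\<close> give the coordinates of \<open>y\<close>.\<close>
  have "I \<subseteq> B"
    using gen[OF BV] fw by (auto simp: I_def)
  show ?thesis
  proof (rule that[of B])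
    show "B \<in> optimal_bases c V"
      using BV fc fw by (auto simp: optimal_bases_def)
    fix b assume b: "b \<in> B"
    have "u z * representation B z b \<ge> 0" if z: "z \<in> W" for z
    proof (cases "u z = 0")
      case False
      obtain v where v: "v \<in> B" "z = g v" using tight[OF z False] \<open>I \<subseteq> B\<close> by auto
      have "c v \<ge> 1" using c v B(1) by (auto simp: I_def)
      then show ?thesis using u(1)[OF z] v
        by (simp add: g_def representation_scale_bases[OF BV] representation_base_bases[OF BV])
    qed simp
    then have "representation B (d *\<^sub>R y) b \<ge> 0"
      unfolding u(3)[symmetric] representation_sum_bases[OF BV] representation_scale_bases[OF BV]
      by (rule sum_nonneg)
    then show "representation B y b \<ge> 0"
      using d by (simp add: representation_scale_bases[OF BV] zero_le_mult_iff)
  qed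
qed

text \<open>For generic \<open>w\<close>, the points \<open>x\<close> such that \<open>x + s *\<^sub>R w\<close> lies in the open cone over \<open>B\<close> for all small \<open>s > 0\<close>.\<close>

definition half_open_cone :: "'a::euclidean_space \<Rightarrow> 'a set \<Rightarrow> 'a set" where
  "half_open_cone w B =
     {x. \<forall>b\<in>B. if representation B w b > 0 then representation B x b \<ge> 0 else representation B x b > 0}"

section \<open>Partition into half-open cones\<close>

lemma eventually_sign_at_right:
  fixes p q :: real
  assumes "q \<noteq> 0"
  shows "eventually (\<lambda>s. p + s * q \<noteq> 0 \<and> (p + s * q > 0 \<longleftrightarrow> (if q > 0 then p \<ge> 0 else p > 0))) (at_right 0)"
proof -
  have lim: "((\<lambda>s. p + s * q) \<longlongrightarrow> p) (at_right 0)"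
    by (auto intro!: tendsto_eq_intros)
  have pos: "eventually (\<lambda>s::real. s > 0) (at_right 0)"
    by (rule eventually_at_right_less)
  consider "p > 0" | "p < 0" | "p = 0" by linarith
  then show ?thesis
  proof cases
    case 1
    from order_tendstoD(1)[OF lim 1] show ?thesis by eventually_elim (use 1 in auto)
  next
    case 2
    from order_tendstoD(2)[OF lim 2] show ?thesis by eventually_elim (use 2 in auto)
  next
    case 3
    from pos show ?thesis by eventually_elim (use 3 assms in \<open>auto simp: zero_less_mult_iff\<close>)
  qed
qed

text \<open>For small \<open>s > 0\<close> the point \<open>x + s *\<^sub>R w\<close> is generic and
  its coordinate signs encode membership of \<open>x\<close> in the half-open cones. Covering gives
  existence; uniqueness comes from comparing optimal bases with positive coordinates.\<close>

lemma half_open_cone_partition: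
  fixes V :: "'a::euclidean_space set"
  assumes fin: "finite V" and int: "0 \<in> interior (convex hull V)"
    and c: "\<And>v. v \<in> V \<Longrightarrow> 1 \<le> c v \<and> c v \<le> 2"
    and gen: "\<And>B v. B \<in> bases V \<Longrightarrow> v \<in> V - B \<Longrightarrow> weight c B v \<noteq> c v"
    and w: "generic V w"
  shows "\<exists>!B. B \<in> optimal_bases c V \<and> x \<in> half_open_cone w B"
proof -
  define decided where "decided = (\<lambda>s. \<forall>B\<in>bases V. \<forall>b\<in>B. representation B (x + s *\<^sub>R w) b \<noteq> 0 \<and>
      (representation B (x + s *\<^sub>R w) b > 0 \<longleftrightarrow>
       (if representation B w b > 0 then representation B x b \<ge> 0 else representation B x b > 0)))"
  have "eventually (\<lambda>s. representation B (x + s *\<^sub>R w) b \<noteq> 0 \<and>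
      (representation B (x + s *\<^sub>R w) b > 0 \<longleftrightarrow>
       (if representation B w b > 0 then representation B x b \<ge> 0 else representation B x b > 0))) (at_right 0)"
    if B: "B \<in> bases V" "b \<in> B" for B b
    unfolding representation_add_bases[OF B(1)] representation_scale_bases[OF B(1)]
    by (rule eventually_sign_at_right[OF generic_representation_ne_0[OF w B]])
  then have E1: "eventually decided (at_right 0)"
    unfolding decided_def
    using finite_bases[OF fin] basesD(4) by (intro eventually_ball_finite ballI) blast+
  \<comment> \<open>Two parameters with points in \<open>span S\<close> would put \<open>w\<close>
    there, so each proper span excludes at most one \<open>s\<close>.\<close>
  have "eventually (\<lambda>s. x + s *\<^sub>R w \<notin> span S) (at_right 0)" if S: "S \<subseteq> V" "span S \<noteq> UNIV" for S
  proof -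
    have "s = s'" if "x + s *\<^sub>R w \<in> span S" "x + s' *\<^sub>R w \<in> span S" for s s'
    proof (rule ccontr)
      assume ne: "s \<noteq> s'"
      have "(s - s') *\<^sub>R w \<in> span S"
        using span_diff[OF that] by (simp add: algebra_simps)
      then have "(1 / (s - s')) *\<^sub>R ((s - s') *\<^sub>R w) \<in> span S" by (rule span_scale)
      then show False using ne w S by (auto simp: generic_def)
    qed
    then have "finite {s. x + s *\<^sub>R w \<in> span S}"
      by (metis (mono_tags, lifting) mem_Collect_eq finite.emptyI finite_insert finite_subset insertI1 subsetI)
    from eventually_notin_finite_at_right[OF this] show ?thesis by simp
  qed
  then have "eventually (\<lambda>s. \<forall>S\<in>{S. S \<subseteq> V \<and> span S \<noteq> UNIV}. x + s *\<^sub>R w \<notin> span S) (at_right 0)"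
    using fin by (intro eventually_ball_finite) auto
  then have E2: "eventually (\<lambda>s. generic V (x + s *\<^sub>R w)) (at_right 0)"
    by (rule eventually_mono) (auto simp: generic_def)
  have "\<exists>s. decided s \<and> generic V (x + s *\<^sub>R w)"
    by (rule eventually_happens'[OF trivial_limit_at_right_real eventually_conj[OF E1 E2]])
  then obtain s where ds: "decided s" and gs: "generic V (x + s *\<^sub>R w)"
    by blast
  have s: "representation B (x + s *\<^sub>R w) b \<noteq> 0 \<and>
      (representation B (x + s *\<^sub>R w) b > 0 \<longleftrightarrow>
       (if representation B w b > 0 then representation B x b \<ge> 0 else representation B x b > 0))"
    if "B \<in> bases V" "b \<in> B" for B b
    by (rule bspec[OF bspec[OF ds[unfolded decided_def] that(1)] that(2)])
  have opt: "B \<in> bases V" if "B \<in> optimal_bases c V" for B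
    using that by (simp add: optimal_bases_def)
  have iff: "x \<in> half_open_cone w B \<longleftrightarrow> (\<forall>b\<in>B. representation B (x + s *\<^sub>R w) b > 0)" if "B \<in> bases V" for B
    using s[OF that] by (auto simp: half_open_cone_def)
  obtain B where B: "B \<in> optimal_bases c V" "\<And>b. b \<in> B \<Longrightarrow> representation B (x + s *\<^sub>R w) b \<ge> 0"
    using optimal_bases_cover[OF fin int c gen gs] by blast
  show ?thesis
  proof (rule ex1I[of _ B])
    show "B \<in> optimal_bases c V \<and> x \<in> half_open_cone w B"
      using B iff[OF opt[OF B(1)]] s[OF opt[OF B(1)]] by (simp add: order_less_le)
    fix B' assume B': "B' \<in> optimal_bases c V \<and> x \<in> half_open_cone w B'"
    show "B' = B"
    proof (rule optimal_bases_unique[OF _ B(1) gen])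
      show "representation B' (x + s *\<^sub>R w) b > 0" if "b \<in> B'" for b
        using that B' iff[OF opt] by blast
      show "representation B (x + s *\<^sub>R w) b > 0" if "b \<in> B" for b
        using that B s[OF opt[OF B(1)]] by (simp add: order_less_le)
    qed (use B' in auto)
  qed
qed

subsection \<open>Lattice points in half-open cones\<close>

lemma
  shows lattice_points_0: "0 \<in> lattice_points"
    and lattice_points_add: "x \<in> lattice_points \<Longrightarrow> y \<in> lattice_points \<Longrightarrow> x + y \<in> lattice_points"
    and lattice_points_diff: "x \<in> lattice_points \<Longrightarrow> y \<in> lattice_points \<Longrightarrow> x - y \<in> lattice_points"
    and lattice_points_scale: "x \<in> lattice_points \<Longrightarrow> real k *\<^sub>R x \<in> lattice_points"
  by (auto simp: lattice_points_def)

lemma lattice_points_sum: "(\<And>i. i \<in> I \<Longrightarrow> f i \<in> lattice_points) \<Longrightarrow> sum f I \<in> lattice_points"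
  by (induction I rule: infinite_finite_induct) (auto simp: lattice_points_0 lattice_points_add)

lemma finite_bounded_lattice_points:
  fixes S :: "(real^'n) set"
  assumes "bounded S"
  shows "finite (S \<inter> lattice_points)"
proof -
  obtain r where r: "\<And>x. x \<in> S \<Longrightarrow> norm x \<le> r"
    using assms by (auto simp: bounded_iff)
  define A where "A = (of_int ` {-\<lceil>r\<rceil>..\<lceil>r\<rceil>} :: real set)"
  have "S \<inter> lattice_points \<subseteq> vec_lambda ` (UNIV \<rightarrow>\<^sub>E A)"
  proof
    fix x assume x: "x \<in> S \<inter> lattice_points"
    have "x $ i \<in> A" for i
    proof -
      obtain k where k: "x $ i = of_int k"
        using x by (auto simp: lattice_points_def elim: Ints_cases)
      have "\<bar>x $ i\<bar> \<le> r"
        using component_le_norm_cart[of x i] r x by force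
      then have "k \<in> {-\<lceil>r\<rceil>..\<lceil>r\<rceil>}" using k by (simp add: abs_le_iff) linarith
      then show ?thesis unfolding A_def k by (rule imageI)
    qed
    then have "vec_nth x \<in> UNIV \<rightarrow>\<^sub>E A" by auto
    then show "x \<in> vec_lambda ` (UNIV \<rightarrow>\<^sub>E A)"
      by (intro image_eqI[of _ _ "vec_nth x"]) (simp_all add: vec_nth_inverse)
  qed
  moreover have "finite (vec_lambda ` (UNIV \<rightarrow>\<^sub>E A) :: (real^'n) set)"
    by (intro finite_imageI finite_PiE) (auto simp: A_def)
  ultimately show ?thesis by (rule finite_subset)
qed

text \<open>Fixing the value \<open>j\<close> at the new element leaves a total of at most
  \<open>n - j\<close> for the rest; the hockey-stick identity sums these counts.\<close>

lemma card_bounded_sum_functions: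
  assumes "finite B"
  shows "finite {k \<in> B \<rightarrow>\<^sub>E (UNIV :: nat set). sum k B \<le> n} \<and>
    card {k \<in> B \<rightarrow>\<^sub>E (UNIV :: nat set). sum k B \<le> n} = (n + card B) choose card B"
  using assms
proof (induction B arbitrary: n rule: finite_induct)
  case empty
  have "{k \<in> {} \<rightarrow>\<^sub>E (UNIV :: nat set). sum k {} \<le> n} = {\<lambda>_. undefined}" by auto
  then show ?case by simp
next
  case (insert b B)
  let ?K = "\<lambda>B n. {k \<in> B \<rightarrow>\<^sub>E (UNIV :: nat set). sum k B \<le> n}"
  have upd: "(\<Sum>x\<in>B. if x = b then j else k x) = sum k B" for k :: "'a \<Rightarrow> nat" and j
    using insert.hyps by (intro sum.cong) auto
  have "bij_betw (\<lambda>(j, k). k(b := j)) (SIGMA j:{..n}. ?K B (n - j)) (?K (insert b B) n)"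
  proof (rule bij_betwI[where g="\<lambda>k. (k b, k(b := undefined))"])
    show "(\<lambda>(j, k). k(b := j)) \<in> (SIGMA j:{..n}. ?K B (n - j)) \<rightarrow> ?K (insert b B) n"
      using insert.hyps by (auto simp: upd PiE_def extensional_def)
    show "(\<lambda>k. (k b, k(b := undefined))) \<in> ?K (insert b B) n \<rightarrow> (SIGMA j:{..n}. ?K B (n - j))"
      using insert.hyps by (auto simp: upd PiE_def extensional_def)
  qed (use insert.hyps in \<open>auto simp: PiE_def extensional_def fun_eq_iff\<close>)
  from bij_betw_finite[OF this] bij_betw_same_card[OF this]
  have fin: "finite (?K (insert b B) n)" and card: "card (?K (insert b B) n) = card (SIGMA j:{..n}. ?K B (n - j))"
    using insert.IH by simp_all
  note card
  also have "card (SIGMA j:{..n}. ?K B (n - j)) = (\<Sum>j\<le>n. (n - j + card B) choose card B)"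
    using insert.IH by (subst card_SigmaI) auto
  also have "\<dots> = (\<Sum>j\<le>n. (card B + j) choose card B)"
    by (rule sum.reindex_bij_witness[of _ "\<lambda>j. n - j" "\<lambda>j. n - j"]) (auto simp: add.commute)
  also have "\<dots> = (n + card (insert b B)) choose card (insert b B)"
    using insert.hyps unfolding choose_rising_sum(1) by (simp add: add.commute)
  finally show ?case using fin by simp
qed

text \<open>Subtract the floor for \<open>{0..<1}\<close> and the ceiling minus one for
  \<open>{0<..1}\<close>; two points of such an interval differ by less than 1.\<close>

lemma
  fixes r :: real
  defines "J \<equiv> \<lambda>s. if s then {0..<1} else {0<..1::real}"
  shows half_open_unit_interval_ex: "(if s then r \<ge> 0 else r > 0) \<Longrightarrow> \<exists>k::nat. r - real k \<in> J s"
    and half_open_unit_interval_unique: "r - real k \<in> J s \<Longrightarrow> r - real k' \<in> J s \<Longrightarrow> k = k'"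
proof -
  show "\<exists>k::nat. r - real k \<in> J s" if "if s then r \<ge> 0 else r > 0"
  proof (cases s)
    case True
    then have "r - real (nat \<lfloor>r\<rfloor>) \<in> J s" using that by (simp add: J_def) linarith
    then show ?thesis ..
  next
    case False
    then have "r - real (nat (\<lceil>r\<rceil> - 1)) \<in> J s" using that by (simp add: J_def) linarith
    then show ?thesis ..
  qed
  show "k = k'" if "r - real k \<in> J s" "r - real k' \<in> J s"
  proof -
    have "\<bar>real k - real k'\<bar> < 1" using that by (auto simp: J_def split: if_splits)
    then show ?thesis by linarith
  qed
qed

text \<open>For a basis \<open>B\<close> of lattice points, this picks one representative of each
  lattice class modulo integer combinations of \<open>B\<close>. Which end is closed follows
  \<open>half_open_cone\<close>.\<close>

definition fundamental_box :: "real^'n \<Rightarrow> (real^'n) set \<Rightarrow> (real^'n) set" where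
  "fundamental_box w B = {x \<in> lattice_points.
     \<forall>b\<in>B. representation B x b \<in> (if representation B w b > 0 then {0..<1} else {0<..1})}"

lemma finite_fundamental_box:
  assumes "B \<in> bases V"
  shows "finite (fundamental_box w B)"
proof -
  have "norm x \<le> (\<Sum>b\<in>B. norm b)" if "x \<in> fundamental_box w B" for x
  proof -
    have "norm x = norm (\<Sum>b\<in>B. representation B x b *\<^sub>R b)"
      by (simp add: sum_representation_bases[OF assms])
    also have "\<dots> \<le> (\<Sum>b\<in>B. norm b)"
      using that
      by (intro sum_norm_le) (auto simp: fundamental_box_def mult_left_le_one_le split: if_splits)
    finally show ?thesis .
  qed
  then have "bounded (fundamental_box w B)" by (auto simp: bounded_iff)
  from finite_bounded_lattice_points[OF this] show ?thesis
    by (rule rev_finite_subset) (auto simp: fundamental_box_def)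
qed

text \<open>Rounding loses nothing on a fundamental box once weights of lattice points are
  integral.\<close>

definition height :: "'a::euclidean_space set \<Rightarrow> 'a \<Rightarrow> nat" where
  "height B x = nat \<lfloor>weight (\<lambda>_. 1) B x\<rfloor>"

lemma fundamental_box_height:
  fixes B :: "(real^'n) set"
  assumes B: "B \<in> bases V" and p: "p \<in> fundamental_box w B"
    and int: "\<And>x. x \<in> lattice_points \<Longrightarrow> weight (\<lambda>_. 1) B x \<in> \<int>"
  shows "weight (\<lambda>_. 1) B p = real (height B p)" "height B p \<le> CARD('n)"
proof -
  have rep: "0 \<le> representation B p b \<and> representation B p b \<le> 1" if "b \<in> B" for b
  proof -
    have "representation B p b \<in> (if representation B w b > 0 then {0..<1} else {0<..1})"
      using that p by (simp add: fundamental_box_def)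
    then show ?thesis by (auto split: if_splits)
  qed
  have "weight (\<lambda>_. 1) B p \<ge> 0"
    unfolding weight_def using rep by (intro sum_nonneg) auto
  moreover have "weight (\<lambda>_. 1) B p \<in> \<int>" using int p by (simp add: fundamental_box_def)
  ultimately show *: "weight (\<lambda>_. 1) B p = real (height B p)"
    by (auto simp: height_def elim!: Ints_cases)
  have "weight (\<lambda>_. 1) B p \<le> (\<Sum>b\<in>B. 1)"
    unfolding weight_def using rep by (intro sum_mono) auto
  then have "real (height B p) \<le> real CARD('n)"
    using basesD(5)[OF B] unfolding * by simp
  then show "height B p \<le> CARD('n)" by simp
qed

text \<open>A lattice point of the half-open cone is uniquely a box point plus a nonnegative integer
  combination of \<open>B\<close>. Weights add, so a box point of height \<open>h \<le> m\<close>
  allows coefficient sums up to \<open>m - h\<close>, which gives the binomial.\<close>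

lemma card_half_open_cone:
  fixes B :: "(real^'n) set"
  assumes B: "B \<in> bases V" and V: "V \<subseteq> lattice_points"
    and int: "\<And>x. x \<in> lattice_points \<Longrightarrow> weight (\<lambda>_. 1) B x \<in> \<int>"
  shows "card {x \<in> half_open_cone w B \<inter> lattice_points. weight (\<lambda>_. 1) B x \<le> real m} =
    (\<Sum>p\<in>fundamental_box w B. (m + CARD('n) - height B p) choose CARD('n))"
proof -
  let ?K = "\<lambda>p. {k \<in> B \<rightarrow>\<^sub>E (UNIV :: nat set). height B p + sum k B \<le> m}"
  let ?C = "{x \<in> half_open_cone w B \<inter> lattice_points. weight (\<lambda>_. 1) B x \<le> real m}"
  let ?t = "\<lambda>k::real^'n \<Rightarrow> nat. \<Sum>b\<in>B. real (k b) *\<^sub>R b"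
  note finB = basesD(4)[OF B]
  note cardB = basesD(5)[OF B]
  have rep_t: "representation B (?t k) b = real (k b)" if "b \<in> B" for k b
    by (rule representation_eqI_bases[OF B refl that])
  have t_lattice: "?t k \<in> lattice_points" for k
    using basesD(1)[OF B] V by (intro lattice_points_sum lattice_points_scale) auto
  have weight_t: "weight (\<lambda>_. 1) B (?t k) = real (sum k B)" for k
    unfolding weight_def by (simp add: rep_t)
  have "bij_betw (\<lambda>(p, k). p + ?t k) (SIGMA p:fundamental_box w B. ?K p) ?C"
  proof (rule bij_betw_imageI)
    show "inj_on (\<lambda>(p, k). p + ?t k) (SIGMA p:fundamental_box w B. ?K p)"
    proof (rule inj_onI, clarsimp)
      fix p k p' k'
      assume p: "p \<in> fundamental_box w B" "p' \<in> fundamental_box w B"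
        and k: "k \<in> B \<rightarrow>\<^sub>E UNIV" "k' \<in> B \<rightarrow>\<^sub>E UNIV"
        and eq: "p + ?t k = p' + ?t k'"
      have "k b = k' b" if b: "b \<in> B" for b
      proof (rule half_open_unit_interval_unique)
        let ?r = "representation B (p + ?t k) b"
        show "?r - real (k b) \<in> (if representation B w b > 0 then {0..<1} else {0<..1})"
          using p(1) b by (simp add: representation_add_bases[OF B] rep_t fundamental_box_def)
        show "?r - real (k' b) \<in> (if representation B w b > 0 then {0..<1} else {0<..1})"
          unfolding eq using p(2) b by (simp add: representation_add_bases[OF B] rep_t fundamental_box_def)
      qed
      then have "k = k'" by (rule PiE_ext[OF k])
      then show "p = p' \<and> k = k'" using eq by simp
    qed
    show "(\<lambda>(p, k). p + ?t k) ` (SIGMA p:fundamental_box w B. ?K p) = ?C"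
    proof (intro equalityI subsetI)
      fix x assume "x \<in> (\<lambda>(p, k). p + ?t k) ` (SIGMA p:fundamental_box w B. ?K p)"
      then obtain p k where x: "x = p + ?t k" and p: "p \<in> fundamental_box w B"
        and k: "height B p + sum k B \<le> m" by auto
      have "weight (\<lambda>_. 1) B x = real (height B p + sum k B)"
        by (simp add: x weight_add[OF B] weight_t fundamental_box_height(1)[OF B p int])
      then have "weight (\<lambda>_. 1) B x \<le> real m" using k by linarith
      moreover have "x \<in> lattice_points"
        using p unfolding x by (intro lattice_points_add t_lattice) (simp add: fundamental_box_def)
      moreover have "x \<in> half_open_cone w B"
        unfolding half_open_cone_def
      proof (clarify)
        fix b assume b: "b \<in> B"
        have "representation B p b \<in> (if representation B w b > 0 then {0..<1} else {0<..1})"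
          using p b by (simp add: fundamental_box_def)
        then show "if representation B w b > 0 then representation B x b \<ge> 0 else representation B x b > 0"
          unfolding x representation_add_bases[OF B] rep_t[OF b] by (auto split: if_splits)
      qed
      ultimately show "x \<in> ?C" by simp
    next
      fix x assume x: "x \<in> ?C"
      have "\<exists>k::nat. representation B x b - real k \<in> (if representation B w b > 0 then {0..<1} else {0<..1})"
        if "b \<in> B" for b
        using x that by (intro half_open_unit_interval_ex) (simp add: half_open_cone_def)
      then obtain k where k: "\<And>b. b \<in> B \<Longrightarrow>
          representation B x b - real (k b) \<in> (if representation B w b > 0 then {0..<1} else {0<..1})"
        by metis
      define k' where "k' = restrict k B"
      define p where "p = x - ?t k'"
      have xp: "x = p + ?t k'" by (simp add: p_def)
      have p: "p \<in> fundamental_box w B"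
        using x k t_lattice
        by (simp add: fundamental_box_def p_def lattice_points_diff representation_diff_bases[OF B] rep_t k'_def)
      have "weight (\<lambda>_. 1) B x = real (height B p + sum k' B)"
        by (simp add: xp weight_add[OF B] weight_t fundamental_box_height(1)[OF B p int])
      then have "real (height B p + sum k' B) \<le> real m" using x by simp
      then have "height B p + sum k' B \<le> m" by (simp only: of_nat_le_iff)
      then show "x \<in> (\<lambda>(p, k). p + ?t k) ` (SIGMA p:fundamental_box w B. ?K p)"
        using p xp by (intro image_eqI[of _ _ "(p, k')"]) (auto simp: k'_def)
    qed
  qed
  then have "card ?C = card (SIGMA p:fundamental_box w B. ?K p)"
    by (rule bij_betw_same_card[symmetric])
  also have "\<dots> = (\<Sum>p\<in>fundamental_box w B. (m + CARD('n) - height B p) choose CARD('n))"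
  proof -
    have K: "finite (?K p) \<and> card (?K p) = (m + CARD('n) - height B p) choose CARD('n)"
      if p: "p \<in> fundamental_box w B" for p
    proof (cases "height B p \<le> m")
      case True
      then have "?K p = {k \<in> B \<rightarrow>\<^sub>E (UNIV :: nat set). sum k B \<le> m - height B p}" by auto
      then show ?thesis using card_bounded_sum_functions[OF finB, of "m - height B p"] True cardB by simp
    next
      case False
      then have "?K p = {}" by auto
      \<comment> \<open>No point has this box part, and the formula agrees: even with truncated
        subtraction the upper index is below \<open>CARD('n)\<close>.\<close>
      moreover have "m + CARD('n) - height B p < CARD('n)"
        using False zero_less_card_finite[where 'a='n] by linarith
      ultimately show ?thesis by (metis binomial_eq_0 card.empty finite.emptyI)
    qed
    then show ?thesis
      using finite_fundamental_box[OF B] by (subst card_SigmaI) auto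
  qed
  finally show ?thesis .
qed

text \<open>Reflection sends a coordinate \<open>r\<close> to \<open>1 - r\<close>, exchanging
  \<open>{0..<1}\<close> with \<open>{0<..1}\<close>. Negating \<open>w\<close> makes the same
  exchange, as its coordinates are nonzero.\<close>

lemma fundamental_box_uminus:
  fixes B :: "(real^'n) set"
  assumes B: "B \<in> bases V" and V: "V \<subseteq> lattice_points"
    and w: "\<And>b. b \<in> B \<Longrightarrow> representation B w b \<noteq> 0"
  shows "bij_betw (\<lambda>p. \<Sum>B - p) (fundamental_box w B) (fundamental_box (- w) B)"
proof -
  have sum_lattice: "\<Sum>B \<in> lattice_points"
    using basesD(1)[OF B] V by (intro lattice_points_sum) auto
  have rep_sum: "representation B (\<Sum>B) b = 1" if "b \<in> B" for b
    by (rule representation_eqI_bases[OF B _ that]) simp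
  have box: "\<Sum>B - p \<in> fundamental_box (- w) B"
    if p: "p \<in> fundamental_box w B" and w: "\<And>b. b \<in> B \<Longrightarrow> representation B w b \<noteq> 0" for p w
    unfolding fundamental_box_def
  proof (intro CollectI conjI ballI)
    show "\<Sum>B - p \<in> lattice_points"
      using p sum_lattice by (simp add: fundamental_box_def lattice_points_diff)
    fix b assume b: "b \<in> B"
    have "representation B p b \<in> (if representation B w b > 0 then {0..<1} else {0<..1})"
      using p b by (simp add: fundamental_box_def)
    then show "representation B (\<Sum>B - p) b \<in> (if representation B (- w) b > 0 then {0..<1} else {0<..1})"
      using w[OF b] by (auto simp: representation_diff_bases[OF B] representation_uminus_bases[OF B]
        rep_sum[OF b] split: if_splits)
  qed
  show ?thesis
    by (rule bij_betwI[where g="\<lambda>p. \<Sum>B - p"])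
      (use box[of _ w] box[of _ "-w"] w in \<open>auto simp: representation_uminus_bases[OF B]\<close>)
qed

text \<open>All coordinates of \<open>\<Sum>B\<close> are 1, so its weight is
  \<open>CARD('n)\<close>.\<close>

lemma height_reflect:
  fixes B :: "(real^'n) set"
  assumes B: "B \<in> bases V" and p: "p \<in> fundamental_box w B"
    and int: "\<And>x. x \<in> lattice_points \<Longrightarrow> weight (\<lambda>_. 1) B x \<in> \<int>"
  shows "height B (\<Sum>B - p) = CARD('n) - height B p"
proof -
  have "weight (\<lambda>_. 1) B (\<Sum>B) = real CARD('n)"
    unfolding weight_def using representation_eqI_bases[OF B, of "\<lambda>_. 1" "\<Sum>B"] basesD(5)[OF B] by simp
  then have "weight (\<lambda>_. 1) B (\<Sum>B - p) = real (CARD('n) - height B p)"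
    using fundamental_box_height[OF B p int]
    by (simp add: weight_diff[OF B])
  then show ?thesis by (simp add: height_def)
qed

subsection \<open>The Ehrhart polynomial of a reflexive polytope\<close>

text \<open>Otherwise some nonzero \<open>a\<close> has nonnegative inner product with every point
  of \<open>P\<close>, and all its positive multiples lie in the dual, which is bounded.\<close>

lemma reflexive_polytope_interior:
  fixes P :: "(real^'n) set"
  assumes "reflexive_polytope P"
  shows "0 \<in> interior P"
proof (rule ccontr)
  assume "0 \<notin> interior P"
  have P: "polytope P" "aff_dim P = int CARD('n)" "polytope (dual_polytope P)"
    using assms by (auto simp: reflexive_polytope_def lattice_polytope_def)
  have conv: "convex P" using P(1) by (rule polytope_imp_convex)
  have ne: "interior P \<noteq> {}"
  proof -
    have "affine hull P = UNIV" using P(2) by (simp add: aff_dim_eq_full[symmetric])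
    moreover from this have "P \<noteq> {}" by auto
    ultimately show ?thesis using rel_interior_eq_empty[OF conv] rel_interior_interior by auto
  qed
  obtain a where a: "a \<noteq> 0" "\<And>x. x \<in> interior P \<Longrightarrow> 0 \<le> a \<bullet> x"
    using separating_hyperplane_set_0[OF convex_interior[OF conv] \<open>0 \<notin> interior P\<close>] by blast
  have aP: "0 \<le> a \<bullet> x" if "x \<in> P" for x
  proof -
    have "x \<in> closure (interior P)"
      using that convex_closure_interior[OF conv ne] closure_subset by auto
    moreover have "continuous_on (closure (interior P)) ((\<bullet>) a)" by (intro continuous_intros)
    ultimately show ?thesis using continuous_ge_on_closure[of "interior P" "(\<bullet>) a" x 0] a(2) by blast
  qed
  obtain r where r: "\<And>u. u \<in> dual_polytope P \<Longrightarrow> norm u \<le> r"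
    using polytope_imp_bounded[OF P(3)] by (auto simp: bounded_iff)
  \<comment> \<open>Gives a multiple of \<open>a\<close> of norm \<open>\<bar>r\<bar> + 1\<close>,
    beyond the bound on the dual.\<close>
  define t where "t = (\<bar>r\<bar> + 1) / norm a"
  have "t *\<^sub>R a \<in> dual_polytope P"
    unfolding dual_polytope_def
  proof (intro CollectI ballI)
    fix v assume "v \<in> P"
    then have "0 \<le> t * (a \<bullet> v)" using aP by (simp add: t_def)
    then show "- 1 \<le> (t *\<^sub>R a) \<bullet> v" by simp
  qed
  from r[OF this] show False using a(1) by (simp add: t_def)
qed

text \<open>The height functional is, up to sign, the inner product with a vertex of the dual polytope.\<close>

lemma reflexive_height_integral:
  fixes P :: "(real^'n) set"
  assumes P: "reflexive_polytope P"
    and B: "B \<in> optimal_bases (\<lambda>_. 1) {v. v extreme_point_of P}"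
    and x: "x \<in> lattice_points"
  shows "weight (\<lambda>_. 1) B x \<in> \<int>"
proof -
  let ?V = "{v. v extreme_point_of P}"
  let ?f = "weight (\<lambda>_. 1) B"
  have poly: "polytope P" using P by (auto simp: reflexive_polytope_def lattice_polytope_def)
  have BV: "B \<in> bases ?V" using B by (simp add: optimal_bases_def)
  have f: "linear ?f" by (rule linear_weight[OF BV])
  \<comment> \<open>Minus the vector representing the functional, to match the sign in
    \<open>dual_polytope\<close>.\<close>
  define u where "u = - (\<Sum>i\<in>Basis. ?f i *\<^sub>R i)"
  have fu: "?f y = - (u \<bullet> y)" for y
  proof -
    have "?f y = ?f (\<Sum>i\<in>Basis. (y \<bullet> i) *\<^sub>R i)" by (simp add: euclidean_representation)
    also have "\<dots> = - (u \<bullet> y)"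
      unfolding linear_sum[OF f] linear_cmul[OF f] u_def inner_minus_left inner_sum_left minus_minus
      by (intro sum.cong refl) (simp add: inner_commute)
    finally show ?thesis .
  qed
  have hull: "P = convex hull ?V"
    by (rule Krein_Milman_Minkowski[OF polytope_imp_compact[OF poly] polytope_imp_convex[OF poly]])
  have le1: "?f y \<le> 1" if "y \<in> P" for y
  proof -
    have "?V \<subseteq> {y. u \<bullet> y \<ge> -1}"
    proof
      fix v assume v: "v \<in> ?V"
      then have "?f v \<le> 1" using B by (auto simp: optimal_bases_def)
      then show "v \<in> {y. u \<bullet> y \<ge> -1}" using fu[of v] by simp
    qed
    then have "convex hull ?V \<subseteq> {y. u \<bullet> y \<ge> -1}"
      by (rule hull_minimal) (rule convex_halfspace_ge)
    then have "u \<bullet> y \<ge> -1" using that hull by blast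
    then show ?thesis using fu[of y] by simp
  qed
  have u: "u \<in> dual_polytope P"
    unfolding dual_polytope_def
  proof (intro CollectI ballI)
    fix v assume "v \<in> P"
    from le1[OF this] show "- 1 \<le> u \<bullet> v" using fu[of v] by linarith
  qed
  have tight: "u \<bullet> b = -1" if "b \<in> B" for b
    using fu[of b] weight_base[OF BV that, of "\<lambda>_. 1"] by simp
  have "u extreme_point_of dual_polytope P"
    unfolding extreme_point_of_def
  proof (intro conjI u ballI notI)
    fix y z assume yz: "y \<in> dual_polytope P" "z \<in> dual_polytope P" "u \<in> open_segment y z"
    then obtain t where t: "0 < t" "t < 1" "u = (1 - t) *\<^sub>R y + t *\<^sub>R z" and "y \<noteq> z"
      by (auto simp: in_segment)
    \<comment> \<open>The inequality at \<open>b\<close> is tight at \<open>u\<close>, hence at both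
      ends of the segment; as \<open>B\<close> spans, the ends coincide.\<close>
    have "b \<bullet> (y - z) = 0" if b: "b \<in> B" for b
    proof -
      have "b \<in> P" using b basesD(1)[OF BV] by (auto simp: extreme_point_of_def)
      then have ge: "y \<bullet> b + 1 \<ge> 0" "z \<bullet> b + 1 \<ge> 0" using yz by (force simp: dual_polytope_def)+
      have "(1 - t) * (y \<bullet> b + 1) + t * (z \<bullet> b + 1) = 0"
        using tight[OF b] unfolding t(3) by (simp add: inner_add_left algebra_simps)
      then have "(1 - t) * (y \<bullet> b + 1) = 0 \<and> t * (z \<bullet> b + 1) = 0"
        using t ge by (subst (asm) add_nonneg_eq_0_iff) auto
      then show ?thesis using t by (simp add: inner_diff_right inner_commute)
    qed
    then have "orthogonal (y - z) b" if "b \<in> B" for b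
      using that by (simp add: orthogonal_def inner_commute)
    then have "orthogonal (y - z) (y - z)"
      using orthogonal_to_span[of "y - z" B "y - z"] basesD(3)[OF BV] by blast
    then show False using \<open>y \<noteq> z\<close> by (simp add: orthogonal_def)
  qed
  then have "u \<in> lattice_points"
    using P by (auto simp: reflexive_polytope_def lattice_polytope_def)
  then show ?thesis
    using x unfolding fu inner_vec_def lattice_points_def by auto
qed

text \<open>On the cone over \<open>B\<close> the weight is the gauge of \<open>P\<close>.
  Conversely, for \<open>m > 0\<close>, \<open>x\<close> divided by \<open>m\<close> is a convex
  combination of \<open>B\<close> and 0, with the remaining mass \<open>1 - s\<close> at 0.\<close>

lemma scaled_polytope_iff_height_le:
  fixes P :: "'a::euclidean_space set"
  assumes conv: "convex P" and zero: "0 \<in> P" and B: "B \<in> bases V" "V \<subseteq> P"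
    and le1: "\<And>x. x \<in> P \<Longrightarrow> weight (\<lambda>_. 1) B x \<le> 1"
    and pos: "\<And>b. b \<in> B \<Longrightarrow> representation B x b \<ge> 0"
  shows "x \<in> (*\<^sub>R) (real m) ` P \<longleftrightarrow> weight (\<lambda>_. 1) B x \<le> real m"
proof
  assume "x \<in> (*\<^sub>R) (real m) ` P"
  then obtain y where y: "y \<in> P" "x = real m *\<^sub>R y" by auto
  then show "weight (\<lambda>_. 1) B x \<le> real m"
    using mult_left_mono[OF le1[OF y(1)], of "real m"] by (simp add: weight_scale[OF B(1)])
next
  assume le: "weight (\<lambda>_. 1) B x \<le> real m"
  note finB = basesD(4)[OF B(1)]
  have le': "(\<Sum>b\<in>B. representation B x b) \<le> real m" using le by (simp add: weight_def)
  show "x \<in> (*\<^sub>R) (real m) ` P"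
  proof (cases "m = 0")
    case True
    then have "(\<Sum>b\<in>B. representation B x b) = 0"
      using le' sum_nonneg[of B "representation B x"] pos by simp
    then have "\<forall>b\<in>B. representation B x b = 0"
      using sum_nonneg_eq_0_iff[OF finB, of "representation B x"] pos by blast
    then have "x = 0" using sum_representation_bases[OF B(1), of x] by simp
    then show ?thesis using zero by force
  next
    case False
    define s where "s = (\<Sum>b\<in>B. representation B x b / real m)"
    have s: "0 \<le> s" "s \<le> 1"
      using le' False pos unfolding s_def by (auto simp: sum_nonneg sum_divide_distrib[symmetric] divide_le_eq)
    have "(\<Sum>b\<in>insert 0 B. (if b = 0 then 1 - s else representation B x b / real m) *\<^sub>R b) \<in> P"
    proof (rule convex_sum)
      have B0: "0 \<notin> B" using basesD(2)[OF B(1)] dependent_zero by auto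
      have "(\<Sum>b\<in>B. if b = 0 then 1 - s else representation B x b / real m) = s"
        unfolding s_def using B0 by (intro sum.cong) auto
      then show "(\<Sum>b\<in>insert 0 B. if b = 0 then 1 - s else representation B x b / real m) = 1"
        using B0 finB by simp
    qed (use finB conv zero B basesD(1)[OF B(1)] s pos in auto)
    also have "(\<Sum>b\<in>insert 0 B. (if b = 0 then 1 - s else representation B x b / real m) *\<^sub>R b)
        = (\<Sum>b\<in>B. (1 / real m) *\<^sub>R (representation B x b *\<^sub>R b))"
    proof -
      have B0: "0 \<notin> B" using basesD(2)[OF B(1)] dependent_zero by auto
      have "(\<Sum>b\<in>B. (if b = 0 then 1 - s else representation B x b / real m) *\<^sub>R b)
        = (\<Sum>b\<in>B. (1 / real m) *\<^sub>R (representation B x b *\<^sub>R b))"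
        using B0 by (intro sum.cong) auto
      then show ?thesis using B0 finB by simp
    qed
    also have "\<dots> = (1 / real m) *\<^sub>R x"
      unfolding scaleR_sum_right[symmetric] sum_representation_bases[OF B(1)] ..
    finally have "(1 / real m) *\<^sub>R x \<in> P" .
    then show ?thesis using False by (intro image_eqI[of _ _ "(1 / real m) *\<^sub>R x"]) auto
  qed
qed

text \<open>The half-open cones partition the space, and in each of them the dilate is cut out by a
  bound on the weight.\<close>

lemma num_lattice_points_eq_sum:
  fixes P :: "(real^'n) set"
  defines "V \<equiv> {v. v extreme_point_of P}"
  assumes P: "reflexive_polytope P"
    and c: "\<And>v. v \<in> V \<Longrightarrow> 1 \<le> c v \<and> c v \<le> 2"
    and gen: "\<And>B v. B \<in> bases V \<Longrightarrow> v \<in> V - B \<Longrightarrow> weight c B v \<noteq> c v"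
    and opt: "optimal_bases c V \<subseteq> optimal_bases (\<lambda>_. 1) V"
    and w: "generic V w"
  shows "num_lattice_points ((*\<^sub>R) (real m) ` P) =
    (\<Sum>B\<in>optimal_bases c V. \<Sum>p\<in>fundamental_box w B. (m + CARD('n) - height B p) choose CARD('n))"
proof -
  have poly: "polytope P" and VL: "V \<subseteq> lattice_points"
    using P by (auto simp: reflexive_polytope_def lattice_polytope_def V_def)
  have conv: "convex P" using poly by (rule polytope_imp_convex)
  have hull: "P = convex hull V"
    unfolding V_def by (rule Krein_Milman_Minkowski[OF polytope_imp_compact[OF poly] conv])
  have finV: "finite V"
    unfolding V_def using poly by (simp add: finite_polyhedron_extreme_points polytope_imp_polyhedron)
  have int: "0 \<in> interior (convex hull V)"
    using reflexive_polytope_interior[OF P] hull by simp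
  have zero: "0 \<in> P" using int interior_subset hull by blast
  have VP: "V \<subseteq> P" by (auto simp: V_def extreme_point_of_def)
  have bases: "B \<in> bases V" if "B \<in> optimal_bases c V" for B
    using that by (simp add: optimal_bases_def)
  define A where "A = (\<lambda>B. {x \<in> half_open_cone w B \<inter> lattice_points. weight (\<lambda>_. 1) B x \<le> real m})"
  have le1: "weight (\<lambda>_. 1) B x \<le> 1" if B: "B \<in> optimal_bases c V" and x: "x \<in> P" for B x
  proof -
    have "linear (weight (\<lambda>_. 1) B)" by (rule linear_weight[OF bases[OF B]])
    then have "convex (weight (\<lambda>_. 1) B -` {..1})" by (rule convex_linear_vimage) simp
    moreover have "V \<subseteq> weight (\<lambda>_. 1) B -` {..1}"
      using opt B by (auto simp: optimal_bases_def)
    ultimately have "convex hull V \<subseteq> weight (\<lambda>_. 1) B -` {..1}" by (intro hull_minimal)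
    then show ?thesis using x hull by auto
  qed
  have mem: "x \<in> (*\<^sub>R) (real m) ` P \<longleftrightarrow> weight (\<lambda>_. 1) B x \<le> real m"
    if "B \<in> optimal_bases c V" "x \<in> half_open_cone w B" for B x
  proof (rule scaled_polytope_iff_height_le[OF conv zero bases[OF that(1)] VP le1[OF that(1)]])
    fix b assume "b \<in> B"
    then show "representation B x b \<ge> 0" using that(2) by (auto simp: half_open_cone_def split: if_splits)
  qed
  have part: "\<exists>!B. B \<in> optimal_bases c V \<and> x \<in> half_open_cone w B" for x
    using finV int c gen w by (rule half_open_cone_partition)
  have fin: "finite ((*\<^sub>R) (real m) ` P \<inter> lattice_points)"
    using polytope_imp_bounded[OF poly] by (intro finite_bounded_lattice_points bounded_scaling)
  have union: "(*\<^sub>R) (real m) ` P \<inter> lattice_points = (\<Union>B\<in>optimal_bases c V. A B)"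
  proof (intro equalityI subsetI)
    fix x assume x: "x \<in> (*\<^sub>R) (real m) ` P \<inter> lattice_points"
    obtain B where "B \<in> optimal_bases c V" "x \<in> half_open_cone w B" using part by blast
    then show "x \<in> (\<Union>B\<in>optimal_bases c V. A B)" using x mem by (auto simp: A_def)
  next
    fix x assume "x \<in> (\<Union>B\<in>optimal_bases c V. A B)"
    then show "x \<in> (*\<^sub>R) (real m) ` P \<inter> lattice_points" using mem by (auto simp: A_def)
  qed
  have finO: "finite (optimal_bases c V)"
    using finite_bases[OF finV] by (rule rev_finite_subset) (auto simp: optimal_bases_def)
  have "num_lattice_points ((*\<^sub>R) (real m) ` P) = (\<Sum>B\<in>optimal_bases c V. card (A B))"
    unfolding num_lattice_points_def union
  proof (rule card_UN_disjoint[OF finO])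
    show "\<forall>B\<in>optimal_bases c V. finite (A B)"
      using fin unfolding union by (meson UN_upper finite_subset)
    show "\<forall>B\<in>optimal_bases c V. \<forall>B'\<in>optimal_bases c V. B \<noteq> B' \<longrightarrow> A B \<inter> A B' = {}"
      using part by (auto simp: A_def)
  qed
  also have "\<dots> = (\<Sum>B\<in>optimal_bases c V. \<Sum>p\<in>fundamental_box w B. (m + CARD('n) - height B p) choose CARD('n))"
  proof (rule sum.cong[OF refl])
    fix B assume B: "B \<in> optimal_bases c V"
    have "B \<in> optimal_bases (\<lambda>_. 1) {v. v extreme_point_of P}" using B opt V_def by blast
    from card_half_open_cone[OF bases[OF B] VL reflexive_height_integral[OF P this]]
    show "card (A B) = (\<Sum>p\<in>fundamental_box w B. (m + CARD('n) - height B p) choose CARD('n))"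
      by (simp add: A_def)
  qed
  finally show ?thesis .
qed

section \<open>The functional equation of the Ehrhart polynomial\<close>

lemma poly_eqI_of_nat:
  fixes p q :: "'a::{idom,ring_char_0} poly"
  assumes "\<And>m. poly p (of_nat m) = poly q (of_nat m)"
  shows "p = q"
proof (rule ccontr)
  assume "p \<noteq> q"
  then have "finite {x. poly (p - q) x = 0}" by (intro poly_roots_finite) simp
  moreover have "range of_nat \<subseteq> {x. poly (p - q) x = 0}" using assms by auto
  ultimately have "finite (range (of_nat :: nat \<Rightarrow> 'a))" by (rule rev_finite_subset)
  from finite_imageD[OF this inj_of_nat] show False by simp
qed

text \<open>The sum over boxes counts the lattice points for every generic direction. Comparing
  \<open>w\<close> with \<open>- w\<close> through the box reflection gives the symmetry.\<close>

lemma reflexive_ehrhart_polynomial: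
  fixes P :: "(real^'n) set"
  assumes P: "reflexive_polytope P"
  obtains L :: "real poly" where "degree L \<le> CARD('n)"
    and "\<And>m. poly L (real m) = real (num_lattice_points ((*\<^sub>R) (real m) ` P))"
    and "\<And>z. poly L (- 1 - z) = (- 1) ^ CARD('n) * poly L z"
proof -
  define V where "V = {v. v extreme_point_of P}"
  let ?d = "CARD('n)"
  have poly: "polytope P" and VL: "V \<subseteq> lattice_points"
    using P by (auto simp: reflexive_polytope_def lattice_polytope_def V_def)
  have finV: "finite V"
    unfolding V_def using poly by (simp add: finite_polyhedron_extreme_points polytope_imp_polyhedron)
  obtain c where c: "\<And>v. v \<in> V \<Longrightarrow> 1 \<le> c v \<and> c v \<le> 2"
    and gen: "\<And>B v. B \<in> bases V \<Longrightarrow> v \<in> V - B \<Longrightarrow> weight c B v \<noteq> c v"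
    and opt: "optimal_bases c V \<subseteq> optimal_bases (\<lambda>_. 1) V"
    using exists_generic_cost[OF finV] by blast
  obtain w where w: "generic V w" using exists_generic[OF finV] .
  have w': "generic V (- w)"
    using w span_neg[of "- w"] unfolding generic_def by (metis add.inverse_inverse)
  define q where "q = (\<lambda>h. smult (1 / fact ?d) (\<Prod>i<?d. [:real ?d - real h - real i, 1:]))"
  have poly_q: "poly (q h) z = (z + real ?d - real h) gchoose ?d" for h z
    by (simp add: q_def gbinomial_prod_rev poly_prod lessThan_atLeast0 algebra_simps)
  have deg_q: "degree (q h) \<le> ?d" for h
    unfolding q_def
    using degree_prod_sum_le[of "{..<?d}" "\<lambda>i. [:real ?d - real h - real i, 1:]"]
    by (intro order_trans[OF degree_smult_le]) simp
  define S where "S = (\<lambda>w. \<Sum>B\<in>optimal_bases c V. \<Sum>p\<in>fundamental_box w B. q (height B p))"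
  have bases: "B \<in> bases V" if "B \<in> optimal_bases c V" for B
    using that by (simp add: optimal_bases_def)
  have int: "weight (\<lambda>_. 1) B x \<in> \<int>" if "B \<in> optimal_bases c V" "x \<in> lattice_points" for B x
    using subsetD[OF opt that(1)] unfolding V_def by (rule reflexive_height_integral[OF P _ that(2)])
  have S: "poly (S w) (real m) = real (num_lattice_points ((*\<^sub>R) (real m) ` P))" if w: "generic V w" for w m
  proof -
    have "poly (q (height B p)) (real m) = real ((m + ?d - height B p) choose ?d)"
      if "B \<in> optimal_bases c V" "p \<in> fundamental_box w B" for B p
      using fundamental_box_height(2)[OF bases[OF that(1)] that(2) int[OF that(1)]]
      by (simp add: poly_q binomial_gbinomial of_nat_diff)
    moreover have "num_lattice_points ((*\<^sub>R) (real m) ` P) =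
        (\<Sum>B\<in>optimal_bases c V. \<Sum>p\<in>fundamental_box w B. (m + ?d - height B p) choose ?d)"
      by (rule num_lattice_points_eq_sum[OF P, folded V_def, OF c gen opt w])
    ultimately show ?thesis
      by (simp add: S_def poly_sum)
  qed
  \<comment> \<open>Both polynomials count the same lattice points, although their boxes
    differ.\<close>
  have S_uminus: "S (- w) = S w"
    by (rule poly_eqI_of_nat) (simp add: S w w')
  \<comment> \<open>Negating the upper index of the binomial turns height \<open>h\<close> into
    \<open>d - h\<close>.\<close>
  have q_reflect: "poly (q h) (- 1 - z) = (- 1) ^ ?d * poly (q (?d - h)) z" if "h \<le> ?d" for h z
    using that unfolding poly_q by (subst gbinomial_negated_upper) (simp add: of_nat_diff algebra_simps)
  have "poly (S w) (- 1 - z) = (- 1) ^ ?d * poly (S (- w)) z" for z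
  proof -
    have "(\<Sum>p\<in>fundamental_box w B. poly (q (height B p)) (- 1 - z))
        = (-1) ^ ?d * (\<Sum>p\<in>fundamental_box (- w) B. poly (q (height B p)) z)"
      if B: "B \<in> optimal_bases c V" for B
    proof -
      have "(\<Sum>p\<in>fundamental_box (- w) B. poly (q (height B p)) z)
          = (\<Sum>p\<in>fundamental_box w B. poly (q (height B (\<Sum>B - p))) z)"
        by (rule sum.reindex_bij_betw[symmetric])
          (rule fundamental_box_uminus[OF bases[OF B] VL generic_representation_ne_0[OF w bases[OF B]]])
      also have "\<dots> = (\<Sum>p\<in>fundamental_box w B. poly (q (?d - height B p)) z)"
        by (intro sum.cong refl) (simp add: height_reflect[OF bases[OF B] _ int[OF B]])
      finally have eq: "(\<Sum>p\<in>fundamental_box (- w) B. poly (q (height B p)) z)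
          = (\<Sum>p\<in>fundamental_box w B. poly (q (?d - height B p)) z)" .
      show ?thesis
        unfolding eq sum_distrib_left
        by (rule sum.cong[OF refl], rule q_reflect, rule fundamental_box_height(2)[OF bases[OF B] _ int[OF B]])
    qed
    then show ?thesis by (simp add: S_def poly_sum sum_distrib_left)
  qed
  show ?thesis
  proof (rule that[of "S w"])
    have "finite (optimal_bases c V)"
      using finite_bases[OF finV] by (rule rev_finite_subset) (auto simp: optimal_bases_def)
    then show "degree (S w) \<le> ?d"
      unfolding S_def using finite_fundamental_box[OF bases]
      by (intro degree_sum_le deg_q)
    show "poly (S w) (- 1 - z) = (- 1) ^ ?d * poly (S w) z" for z
      using \<open>\<And>z. poly (S w) (- 1 - z) = (- 1) ^ ?d * poly (S (- w)) z\<close> S_uminus by simp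
  qed (rule S[OF w])
qed

section \<open>The volume as leading coefficient\<close>

lemma convex_add_scaled:
  fixes P :: "'a::real_vector set"
  assumes "convex P" "x \<in> (*\<^sub>R) s ` P" "y \<in> (*\<^sub>R) t ` P" "s \<ge> 0" "t \<ge> 0"
  shows "x + y \<in> (*\<^sub>R) (s + t) ` P"
proof -
  obtain p q where pq: "p \<in> P" "q \<in> P" "x = s *\<^sub>R p" "y = t *\<^sub>R q" using assms by auto
  show ?thesis
  proof (cases "s + t = 0")
    case True
    then have "s = 0" "t = 0" using assms by auto
    then show ?thesis using pq by auto
  next
    case False
    then have "s / (s + t) + t / (s + t) = 1" by (simp add: add_divide_distrib[symmetric])
    then have "(s / (s + t)) *\<^sub>R p + (t / (s + t)) *\<^sub>R q \<in> P"
      using assms pq by (intro convexD) auto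
    then show ?thesis using False pq
      by (intro image_eqI[of _ _ "(s / (s + t)) *\<^sub>R p + (t / (s + t)) *\<^sub>R q"])
        (auto simp: scaleR_add_right)
  qed
qed

text \<open>Unit cubes at the lattice points of a dilate of \<open>P\<close> fit into a slightly larger dilate and
  cover a slightly smaller one.\<close>

lemma num_lattice_points_bounds:
  fixes P :: "(real^'n) set"
  assumes conv: "convex P" and comp: "compact P" and int: "0 \<in> interior P"
  obtains R where "R \<ge> 0"
    and "\<And>m. R \<le> real m \<Longrightarrow> (real m - R) ^ CARD('n) * measure lebesgue P \<le> real (num_lattice_points ((*\<^sub>R) (real m) ` P))"
    and "\<And>m. real (num_lattice_points ((*\<^sub>R) (real m) ` P)) \<le> (real m + R) ^ CARD('n) * measure lebesgue P"
proof -
  let ?V = "measure lebesgue P"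
  have One_nth: "(One :: real^'n) $ i = 1" for i
    by (simp add: cart_eq_inner_axis inner_sum_left_Basis axis_in_Basis_iff)
  obtain r where r: "r > 0" "ball 0 r \<subseteq> P"
    using int by (auto simp: mem_interior)
  \<comment> \<open>\<open>norm One\<close> is the diagonal of the unit cube; the
    \<open>R\<close>-fold dilate contains every vector of at most that length. The factor 2 gives
    strict inclusion in the open ball.\<close>
  define R where "R = 2 * norm (One :: real^'n) / r"
  have R: "R > 0" using r by (simp add: R_def)
  have cube: "y \<in> (*\<^sub>R) R ` P" if "norm y \<le> norm (One :: real^'n)" for y :: "real^'n"
  proof -
    have "(1 / R) *\<^sub>R y \<in> ball 0 r"
      using that r R by (simp add: R_def field_simps) (smt (verit) zero_less_norm_iff One_non_0)
    then show ?thesis using r R by (intro image_eqI[of _ _ "(1 / R) *\<^sub>R y"]) auto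
  qed
  have cbox_norm: "norm y \<le> norm (One :: real^'n)" if "y \<in> cbox 0 One" for y :: "real^'n"
    using that by (intro norm_le_componentwise) (auto simp: mem_box inner_sum_left_Basis abs_le_iff)
  have meas: "(*\<^sub>R) t ` P \<in> lmeasurable" for t
    using comp by (intro lmeasurable_compact compact_scaling)
  have scale: "measure lebesgue ((*\<^sub>R) t ` P) = t ^ CARD('n) * ?V" if "t \<ge> 0" for t
    using measure_lebesgue_affine[of t 0 P] that by simp
  have fin: "finite ((*\<^sub>R) (real m) ` P \<inter> lattice_points)" for m
    using compact_imp_bounded[OF comp] by (intro finite_bounded_lattice_points bounded_scaling)
  show ?thesis
  proof (rule that[of R])
    show "R \<ge> 0" using R by simp
  next
    fix m :: nat assume m: "R \<le> real m"
    let ?X = "(*\<^sub>R) (real m) ` P \<inter> lattice_points"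
    have "(*\<^sub>R) (real m - R) ` P \<subseteq> (\<Union>x\<in>?X. (+) x ` cbox 0 One)"
    proof
      fix z assume z: "z \<in> (*\<^sub>R) (real m - R) ` P"
      \<comment> \<open>Rounding down puts \<open>z\<close> into the cube at \<open>x\<close>; the
        difference is at most a diagonal, so \<open>x\<close> stays in the \<open>m\<close>-fold
        dilate.\<close>
      define x :: "real^'n" where "x = (\<chi> i. of_int \<lfloor>z $ i\<rfloor>)"
      have x: "x \<in> lattice_points" by (simp add: x_def lattice_points_def)
      have zx: "z - x \<in> cbox 0 One"
        unfolding mem_box_cart x_def vector_minus_component vec_lambda_beta One_nth zero_index
        by (intro allI conjI) linarith+
      have "x - z \<in> (*\<^sub>R) R ` P"
        using cbox_norm[OF zx] by (intro cube) (simp add: norm_minus_commute)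
      from convex_add_scaled[OF conv z this] have "x \<in> (*\<^sub>R) (real m) ` P" using m R by simp
      then have "x \<in> ?X" using x by blast
      moreover have "z \<in> (+) x ` cbox 0 One"
        using zx by (intro image_eqI[of _ _ "z - x"]) simp_all
      ultimately show "z \<in> (\<Union>x\<in>?X. (+) x ` cbox 0 One)" by (rule UN_I)
    qed
    then have "measure lebesgue ((*\<^sub>R) (real m - R) ` P) \<le> measure lebesgue (\<Union>x\<in>?X. (+) x ` cbox 0 (One :: real^'n))"
      using meas fin by (intro measure_mono_fmeasurable fmeasurable.finite_UN)
        (auto simp: measurable_translation fmeasurableD)
    also have "\<dots> \<le> (\<Sum>x\<in>?X. measure lebesgue ((+) x ` cbox 0 (One :: real^'n)))"
      using fin by (intro measure_UNION_le) (auto simp: measurable_translation fmeasurableD)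
    also have "\<dots> = real (num_lattice_points ((*\<^sub>R) (real m) ` P))"
      by (simp add: measure_translation num_lattice_points_def)
    finally show "(real m - R) ^ CARD('n) * ?V \<le> real (num_lattice_points ((*\<^sub>R) (real m) ` P))"
      using scale m by simp
  next
    fix m :: nat
    let ?X = "(*\<^sub>R) (real m) ` P \<inter> lattice_points"
    \<comment> \<open>Open cubes at distinct lattice points are disjoint, so their volumes add
      exactly.\<close>
    have "real (num_lattice_points ((*\<^sub>R) (real m) ` P)) = (\<Sum>x\<in>?X. measure lebesgue ((+) x ` box 0 (One :: real^'n)))"
      by (simp add: measure_translation num_lattice_points_def)
    also have "\<dots> = measure lebesgue (\<Union>x\<in>?X. (+) x ` box 0 (One :: real^'n))"
    proof (rule measure_UNION'[symmetric])
      show "pairwise (\<lambda>x y. disjnt ((+) x ` box 0 One) ((+) y ` box 0 (One :: real^'n))) ?X"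
      proof (rule pairwiseI)
        fix x y :: "real^'n" assume xy: "x \<in> ?X" "y \<in> ?X" "x \<noteq> y"
        show "disjnt ((+) x ` box 0 One) ((+) y ` box 0 (One :: real^'n))"
        proof (rule ccontr)
          assume "\<not> disjnt ((+) x ` box 0 One) ((+) y ` box 0 (One :: real^'n))"
          then obtain s t where st: "s \<in> box 0 One" "t \<in> box 0 (One :: real^'n)" "x + s = y + t"
            unfolding disjnt_def by auto
          have "x $ i = y $ i" for i
          proof -
            obtain k l where kl: "x $ i = of_int k" "y $ i = of_int l"
              using xy by (auto simp: lattice_points_def) (meson Ints_cases)
            have "x $ i - y $ i = t $ i - s $ i"
              using arg_cong[OF st(3), of "\<lambda>v. v $ i"] by simp
            moreover have "0 < s $ i" "s $ i < 1" "0 < t $ i" "t $ i < 1"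
              using st(1,2) unfolding mem_box_cart One_nth zero_index by blast+
            ultimately have "\<bar>real_of_int k - real_of_int l\<bar> < 1" unfolding kl by linarith
            then have "k = l" by linarith
            then show ?thesis using kl by simp
          qed
          then show False using xy(3) by (simp add: vec_eq_iff)
        qed
      qed
    qed (use fin in \<open>auto simp: measurable_translation\<close>)
    also have "\<dots> \<le> measure lebesgue ((*\<^sub>R) (real m + R) ` P)"
    proof (rule measure_mono_fmeasurable)
      show "(\<Union>x\<in>?X. (+) x ` box 0 One) \<subseteq> (*\<^sub>R) (real m + R) ` P"
      proof clarify
        fix x s :: "real^'n" assume "x \<in> P" "s \<in> box 0 One" 
        then show "real m *\<^sub>R x + s \<in> (*\<^sub>R) (real m + R) ` P"
          using R cbox_norm[of s] box_subset_cbox[of 0 "One :: real^'n"]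
          by (intro convex_add_scaled[OF conv] cube) auto
      qed
      show "(\<Union>x\<in>?X. (+) x ` box 0 (One :: real^'n)) \<in> sets lebesgue"
        using fin by (intro sets.finite_UN) (auto simp: measurable_translation fmeasurableD)
    qed (rule meas)
    finally show "real (num_lattice_points ((*\<^sub>R) (real m) ` P)) \<le> (real m + R) ^ CARD('n) * ?V"
      using scale R by simp
  qed
qed

lemma coeff_tendsto:
  fixes p :: "real poly"
  assumes "degree p \<le> d"
  shows "(\<lambda>m. poly p (real m) / real m ^ d) \<longlonglongrightarrow> coeff p d"
proof -
  have poly: "poly p x = (\<Sum>i\<le>d. coeff p i * x ^ i)" for x
    unfolding poly_altdef using assms by (intro sum.mono_neutral_left) (auto simp: coeff_eq_0)
  have "(\<lambda>m. coeff p i * real m ^ i / real m ^ d) \<longlonglongrightarrow> (if i = d then coeff p d else 0)" if "i \<le> d" for i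
  proof (cases "i = d")
    case True
    have "eventually (\<lambda>m. coeff p i * real m ^ i / real m ^ d = coeff p d) sequentially"
      using eventually_gt_at_top[of 0] by eventually_elim (use True in auto)
    then show ?thesis using True by (simp add: tendsto_eventually)
  next
    case False
    then have "d - i > 0" using that by simp
    have "(\<lambda>m. coeff p i * (1 / real m) ^ (d - i)) \<longlonglongrightarrow> coeff p i * 0 ^ (d - i)"
      by (intro tendsto_intros lim_1_over_n)
    moreover have "eventually (\<lambda>m. coeff p i * (1 / real m) ^ (d - i) = coeff p i * real m ^ i / real m ^ d) sequentially"
      using eventually_gt_at_top[of 0]
    proof eventually_elim
      case (elim m)
      have "real m ^ d = real m ^ i * real m ^ (d - i)"
        using that by (simp add: power_add[symmetric])
      then show ?case using elim by (simp add: field_simps)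
    qed
    ultimately have "(\<lambda>m. coeff p i * real m ^ i / real m ^ d) \<longlonglongrightarrow> coeff p i * 0 ^ (d - i)"
      by (rule Lim_transform_eventually)
    then show ?thesis using False \<open>d - i > 0\<close> by (simp add: power_0_left)
  qed
  then have "(\<lambda>m. \<Sum>i\<le>d. coeff p i * real m ^ i / real m ^ d) \<longlonglongrightarrow> (\<Sum>i\<le>d. if i = d then coeff p d else 0)"
    by (intro tendsto_sum) auto
  then show ?thesis by (simp add: poly sum_divide_distrib)
qed

text \<open>The counts lie between \<open>(m - R) ^ d\<close> and \<open>(m + R) ^ d\<close> times
  the volume for large \<open>m\<close>; dividing by \<open>m ^ d\<close> squeezes them to the
  volume.\<close>

lemma coeff_eq_volume:
  fixes P :: "(real^'n) set" and L :: "real poly"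
  assumes conv: "convex P" and comp: "compact P" and int: "0 \<in> interior P"
    and deg: "degree L \<le> CARD('n)"
    and L: "\<And>m. poly L (real m) = real (num_lattice_points ((*\<^sub>R) (real m) ` P))"
  shows "coeff L CARD('n) = measure lebesgue P"
proof -
  let ?d = "CARD('n)"
  obtain R where R: "R \<ge> 0"
    "\<And>m. R \<le> real m \<Longrightarrow> (real m - R) ^ ?d * measure lebesgue P \<le> poly L (real m)"
    "\<And>m. poly L (real m) \<le> (real m + R) ^ ?d * measure lebesgue P"
    using num_lattice_points_bounds[OF conv comp int] unfolding L[symmetric] by blast
  have lim: "(\<lambda>m. (real m + s) ^ ?d * measure lebesgue P / real m ^ ?d) \<longlonglongrightarrow> measure lebesgue P" for s
  proof -
    have "(\<lambda>m. (1 + s * (1 / real m)) ^ ?d * measure lebesgue P) \<longlonglongrightarrow> (1 + s * 0) ^ ?d * measure lebesgue P"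
      by (intro tendsto_intros lim_1_over_n)
    moreover have "eventually (\<lambda>m. (1 + s * (1 / real m)) ^ ?d * measure lebesgue P
        = (real m + s) ^ ?d * measure lebesgue P / real m ^ ?d) sequentially"
      using eventually_gt_at_top[of 0]
    proof eventually_elim
      case (elim m)
      then have "1 + s * (1 / real m) = (real m + s) / real m" by (simp add: field_simps)
      then show ?case by (simp add: power_divide)
    qed
    ultimately have "(\<lambda>m. (real m + s) ^ ?d * measure lebesgue P / real m ^ ?d) \<longlonglongrightarrow> (1 + s * 0) ^ ?d * measure lebesgue P"
      by (rule Lim_transform_eventually)
    then show ?thesis by simp
  qed
  have "(\<lambda>m. poly L (real m) / real m ^ ?d) \<longlonglongrightarrow> measure lebesgue P"
  proof (rule tendsto_sandwich[OF _ _ lim[of "- R"] lim[of R]])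
    show "eventually (\<lambda>m. (real m + - R) ^ ?d * measure lebesgue P / real m ^ ?d \<le> poly L (real m) / real m ^ ?d) sequentially"
      using eventually_ge_at_top[of "nat \<lceil>R\<rceil>"]
      by eventually_elim (use R in \<open>auto intro!: divide_right_mono simp: nat_ceiling_le_eq\<close>)
    show "eventually (\<lambda>m. poly L (real m) / real m ^ ?d \<le> (real m + R) ^ ?d * measure lebesgue P / real m ^ ?d) sequentially"
      using R by (intro always_eventually allI divide_right_mono) auto
  qed
  from LIMSEQ_unique[OF coeff_tendsto[OF deg] this] show ?thesis .
qed

text \<open>Positive volume turns the degree bound into equality, so \<open>L\<close> meets the
  conditions that single out \<open>ehrhart_polynomial\<close>.\<close>

lemma reflexive_polytope_ehrhart:
  fixes P :: "(real^'n) set"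
  assumes P: "reflexive_polytope P"
  obtains L :: "real poly" where "degree L = CARD('n)"
    and "coeff L CARD('n) = measure lebesgue P" and "measure lebesgue P > 0"
    and "poly L 0 = 1" and "poly L 1 = real (num_lattice_points P)"
    and "\<And>z. poly L (- 1 - z) = (- 1) ^ CARD('n) * poly L z"
    and "ehrhart_polynomial P = map_poly complex_of_real L"
proof -
  have poly: "polytope P" using P by (simp add: reflexive_polytope_def lattice_polytope_def)
  have conv: "convex P" and comp: "compact P"
    using poly polytope_imp_convex polytope_imp_compact by auto
  have int: "0 \<in> interior P" by (rule reflexive_polytope_interior[OF P])
  have zero: "0 \<in> P" using int interior_subset by blast
  obtain L :: "real poly" where L: "degree L \<le> CARD('n)"
    "\<And>m. poly L (real m) = real (num_lattice_points ((*\<^sub>R) (real m) ` P))"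
    "\<And>z. poly L (- 1 - z) = (- 1) ^ CARD('n) * poly L z"
    using reflexive_ehrhart_polynomial[OF P] by blast
  have V: "coeff L CARD('n) = measure lebesgue P"
    by (rule coeff_eq_volume[OF conv comp int L(1,2)])
  have "\<not> negligible P"
    using open_not_negligible[OF open_interior, of P] int negligible_subset[OF _ interior_subset] by blast
  then have pos: "measure lebesgue P > 0"
    using negligible_iff_measure0[OF lmeasurable_compact[OF comp]] by (simp add: zero_less_measure_iff)
  have deg: "degree L = CARD('n)"
    using L(1) le_degree[of L "CARD('n)"] V pos by simp
  have img0: "(*\<^sub>R) 0 ` P = {0}" using zero by auto
  have L0: "poly L 0 = 1"
    using L(2)[of 0] img0 by (simp add: num_lattice_points_def lattice_points_0)
  have L1: "poly L 1 = real (num_lattice_points P)"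
    using L(2)[of 1] by simp
  let ?L = "map_poly complex_of_real L"
  have Lc: "poly ?L (of_nat m) = of_nat (num_lattice_points ((*\<^sub>R) (real m) ` P))" for m
  proof -
    have "poly ?L (of_nat m) = of_real (poly L (real m))"
      by (induction L) (simp_all add: map_poly_pCons)
    then show ?thesis using L(2) by simp
  qed
  have "ehrhart_polynomial P = ?L"
    unfolding ehrhart_polynomial_def
  proof (rule the_equality)
    show "degree ?L = CARD('n) \<and> (\<forall>m::nat. poly ?L (of_nat m) = of_nat (num_lattice_points ((*\<^sub>R) (real m) ` P)))"
      using Lc deg by (simp add: degree_map_poly)
    show "Q = ?L" if "degree Q = CARD('n) \<and> (\<forall>m::nat. poly Q (of_nat m) = of_nat (num_lattice_points ((*\<^sub>R) (real m) ` P)))" for Q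
      by (rule poly_eqI_of_nat) (use that Lc in simp)
  qed
  with deg V pos L0 L1 L(3) show ?thesis by (rule that)
qed

subsection \<open>Roots on the critical line\<close>

text \<open>For \<open>z = x + i * y\<close> the imaginary part of \<open>z * (z + 1)\<close> is
  \<open>y * (2 * x + 1)\<close>. If \<open>y = 0\<close>, the value is
  \<open>(x + 1/2)^2 - 1/4\<close>, at most \<open>- 1/4\<close> only for
  \<open>x = - 1/2\<close>.\<close>

lemma Re_eq_minus_half_iff:
  "Re z = - 1 / 2 \<longleftrightarrow> Im (z * (z + 1)) = 0 \<and> Re (z * (z + 1)) \<le> - 1 / 4"
proof
  assume z: "Re z = - 1 / 2"
  have "Re (z * (z + 1)) = - 1 / 4 - (Im z)\<^sup>2"
    using z by (simp add: power2_eq_square)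
  then show "Im (z * (z + 1)) = 0 \<and> Re (z * (z + 1)) \<le> - 1 / 4"
    using z by simp
next
  assume *: "Im (z * (z + 1)) = 0 \<and> Re (z * (z + 1)) \<le> - 1 / 4"
  then have "Im z * (2 * Re z + 1) = 0" by (simp add: algebra_simps)
  then consider "Im z = 0" | "Re z = - 1 / 2" by fastforce
  then show "Re z = - 1 / 2"
  proof cases
    case 1
    then have "(Re z + 1 / 2)\<^sup>2 \<le> 0" using * by (simp add: power2_eq_square algebra_simps)
    then show ?thesis by (simp add: eq_neg_iff_add_eq_0)
  qed
qed

text \<open>By completing the square, \<open>z * (z + 1)\<close> takes every complex value.\<close>

lemma ball_Re_eq_minus_half_iff:
  fixes Q :: "complex \<Rightarrow> bool"
  shows "(\<forall>z. Q (z * (z + 1)) \<longrightarrow> Re z = - 1 / 2) \<longleftrightarrow> (\<forall>t. Q t \<longrightarrow> Im t = 0 \<and> Re t \<le> - 1 / 4)"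
proof -
  have "\<exists>z. z * (z + 1) = t" for t :: complex
  proof
    have "(csqrt (t + 1 / 4))\<^sup>2 = t + 1 / 4" by (rule power2_csqrt)
    then show "(csqrt (t + 1 / 4) - 1 / 2) * ((csqrt (t + 1 / 4) - 1 / 2) + 1) = t"
      by (simp add: power2_eq_square algebra_simps)
  qed
  then show ?thesis unfolding Re_eq_minus_half_iff by metis
qed

lemma linear_roots_le_iff:
  fixes a :: real
  assumes "a > 0"
  shows "(\<forall>t. of_real a * t + 1 = 0 \<longrightarrow> Im t = 0 \<and> Re t \<le> - 1 / 4) \<longleftrightarrow> a \<le> 4"
proof -
  have "of_real a * t + 1 = 0 \<longleftrightarrow> t = of_real (- 1 / a)" for t :: complex
    using assms by (auto simp: field_simps eq_neg_iff_add_eq_0)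
  then have "(\<forall>t. of_real a * t + 1 = 0 \<longrightarrow> Im t = 0 \<and> Re t \<le> - 1 / 4) \<longleftrightarrow> - 1 / a \<le> - 1 / 4"
    by (simp only: simp_thms Im_complex_of_real Re_complex_of_real)
  also have "\<dots> \<longleftrightarrow> a \<le> 4" using assms by (simp add: field_simps)
  finally show ?thesis .
qed

text \<open>Real roots mean \<open>D \<ge> 0\<close>. The larger one is at most \<open>- 1/4\<close>
  iff \<open>sqrt D \<le> b - a / 2\<close>, that is, \<open>a \<le> 2 * b\<close> and
  \<open>D \<le> (b - a / 2)^2\<close>; the latter reduces to
  \<open>4 * b \<le> a + 16\<close>.\<close>

lemma quadratic_roots_le_iff:
  fixes a b :: real
  assumes a: "a > 0"
  shows "(\<forall>t. of_real a * t\<^sup>2 + of_real b * t + 1 = 0 \<longrightarrow> Im t = 0 \<and> Re t \<le> - 1 / 4) \<longleftrightarrow>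
    a \<le> 2 * b \<and> 4 * b \<le> a + 16 \<and> b\<^sup>2 \<ge> 4 * a"
proof
  define D where "D = b\<^sup>2 - 4 * a"
  have eq: "of_real a * t\<^sup>2 + of_real b * t + 1 = 0 \<longleftrightarrow> (2 * of_real a * t + of_real b)\<^sup>2 = of_real D" for t :: complex
  proof -
    have "(2 * of_real a * t + of_real b)\<^sup>2 - of_real D = 4 * of_real a * (of_real a * t\<^sup>2 + of_real b * t + 1)"
      by (simp add: D_def power2_eq_square algebra_simps)
    then show ?thesis using a by (metis eq_iff_diff_eq_0 mult_eq_0_iff of_real_eq_0_iff less_irrefl zero_neq_numeral)
  qed
  {
    assume roots: "\<forall>t. of_real a * t\<^sup>2 + of_real b * t + 1 = 0 \<longrightarrow> Im t = 0 \<and> Re t \<le> - 1 / 4"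
    \<comment> \<open>The principal square root yields a nonreal root for \<open>D < 0\<close> and
      the larger real root otherwise, so this root alone gives all three inequalities.\<close>
    define t where "t = (csqrt (of_real D) - of_real b) / (2 * of_real a)"
    have t2: "2 * of_real a * t + of_real b = csqrt (of_real D)"
      using a by (simp add: t_def)
    then have "of_real a * t\<^sup>2 + of_real b * t + 1 = 0" unfolding eq by simp
    then have t: "Im t = 0" "Re t \<le> - 1 / 4" using roots by auto
    have "Im (csqrt (of_real D)) = 0" using t(1) unfolding t2[symmetric] by simp
    then have D: "D \<ge> 0" by (cases "D \<ge> 0") auto
    then have "Re (csqrt (of_real D)) = sqrt D" by simp
    then have "2 * a * Re t + b = sqrt D" unfolding t2[symmetric] by simp
    moreover have "2 * a * Re t \<le> 2 * a * (- 1 / 4)" using t(2) a by (intro mult_left_mono) auto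
    ultimately have s: "sqrt D \<le> b - a / 2" by simp
    moreover have "sqrt D \<ge> 0" using D by simp
    ultimately have b: "a / 2 \<le> b" by linarith
    have "D \<le> (b - a / 2)\<^sup>2"
      using power_mono[OF s \<open>sqrt D \<ge> 0\<close>, of 2] D by simp
    then have "0 \<le> a * (a + 16 - 4 * b)"
      by (simp add: D_def power2_eq_square field_simps)
    then have "4 * b \<le> a + 16" using a by (simp add: zero_le_mult_iff)
    then show "a \<le> 2 * b \<and> 4 * b \<le> a + 16 \<and> b\<^sup>2 \<ge> 4 * a"
      using b D by (simp add: D_def)
  next
    assume *: "a \<le> 2 * b \<and> 4 * b \<le> a + 16 \<and> b\<^sup>2 \<ge> 4 * a"
    then have D: "D \<ge> 0" by (simp add: D_def)
    have "0 \<le> a * (a + 16 - 4 * b)" using * a by simp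
    then have "D \<le> (b - a / 2)\<^sup>2"
      by (simp add: D_def power2_eq_square field_simps)
    then have s: "sqrt D \<le> b - a / 2" using * by (intro real_le_lsqrt) auto
    show "\<forall>t. of_real a * t\<^sup>2 + of_real b * t + 1 = 0 \<longrightarrow> Im t = 0 \<and> Re t \<le> - 1 / 4"
    proof (intro allI impI)
      fix t :: complex assume "of_real a * t\<^sup>2 + of_real b * t + 1 = 0"
      then have "(2 * of_real a * t + of_real b)\<^sup>2 = (of_real (sqrt D))\<^sup>2"
        unfolding eq using D by (simp flip: of_real_power)
      then obtain r where r: "\<bar>r\<bar> = sqrt D" "2 * of_real a * t + of_real b = of_real r"
        unfolding power2_eq_iff using D by (metis abs_of_nonneg abs_minus_cancel of_real_minus real_sqrt_ge_zero)
      have "t = of_real ((r - b) / (2 * a))" using r(2) a by (simp add: field_simps)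
      moreover have "(r - b) / (2 * a) \<le> - 1 / 4" using r(1) s a by (simp add: field_simps)
      ultimately show "Im t = 0 \<and> Re t \<le> - 1 / 4" by simp
    qed
  }
qed

section \<open>The criteria in dimensions two to five\<close>

lemma sum_atMost_numeral:
  fixes f :: "nat \<Rightarrow> 'a::comm_monoid_add"
  shows "(\<Sum>i\<le>2. f i) = f 0 + f 1 + f 2"
    and "(\<Sum>i\<le>3. f i) = f 0 + f 1 + f 2 + f 3"
    and "(\<Sum>i\<le>4. f i) = f 0 + f 1 + f 2 + f 3 + f 4"
    and "(\<Sum>i\<le>5. f i) = f 0 + f 1 + f 2 + f 3 + f 4 + f 5"
  by (simp_all add: eval_nat_numeral)

theorem theorem1p5:
  fixes P :: "(real ^ 'n) set" and V N :: real
  assumes "reflexive_polytope P"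
    and "V = measure lebesgue P"
    and "N = real (num_lattice_points P)"
  shows "(CARD('n) = 2 \<longrightarrow>
           (CL_polytope P \<longleftrightarrow> V \<le> 4) \<and> (CL_polytope P \<longleftrightarrow> N \<le> 9)) \<and>
         (CARD('n) = 3 \<longrightarrow>
           (CL_polytope P \<longleftrightarrow> V \<le> 8) \<and> (CL_polytope P \<longleftrightarrow> N \<le> 27)) \<and>
         (CARD('n) = 4 \<longrightarrow>
           (CL_polytope P \<longleftrightarrow>
              (V = 16 \<and> N = 81) \<or>
              (5 * V < N - 1 \<and> 2 * N \<le> 9 * (V + 2) \<and> (N - 1 - 4 * V)\<^sup>2 \<ge> 16 * V))) \<and>
         (CARD('n) = 5 \<longrightarrow>
           (CL_polytope P \<longleftrightarrow>
              (V = 32 \<and> N = 243) \<or>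
              (15 * V < 2 * (N - 3) \<and> 4 * N \<le> 27 * (V + 4) \<and> (N - 3 - 6 * V)\<^sup>2 \<ge> 72 * V)))"
proof -
  obtain L :: "real poly" where L: "degree L = CARD('n)" "coeff L CARD('n) = V" "V > 0"
    "poly L 0 = 1" "poly L 1 = N" "\<And>z. poly L (- 1 - z) = (- 1) ^ CARD('n) * poly L z"
    "ehrhart_polynomial P = map_poly complex_of_real L"
    using reflexive_polytope_ehrhart[OF assms(1)] unfolding assms(2,3) by metis
  have CL: "CL_polytope P \<longleftrightarrow> (\<forall>z. (\<Sum>i\<le>CARD('n). of_real (coeff L i) * z ^ i) = 0 \<longrightarrow> Re z = - 1 / 2)"
    by (simp add: CL_polytope_def L poly_altdef degree_map_poly coeff_map_poly)
  have L0: "coeff L 0 = 1" using L(4) by (simp add: poly_0_coeff_0)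
  have Lm1: "poly L (- 1) = (- 1) ^ CARD('n)" using L(6)[of 0] L(4) by simp
  have Lm2: "poly L (- 2) = (- 1) ^ CARD('n) * N" using L(6)[of 1] L(5) by simp
  \<comment> \<open>In odd dimension this forces the root \<open>- 1 / 2\<close>, the source of the
    factor \<open>2 * z + 1\<close> below.\<close>
  have Lhalf: "poly L (- 1 / 2) = (- 1) ^ CARD('n) * poly L (- 1 / 2)" using L(6)[of "- 1 / 2"] by simp
  note poly_L = poly_altdef[of L, unfolded L(1)]
  \<comment> \<open>Here \<open>L = V * t + 1\<close> with \<open>t = z * (z + 1)\<close>, and
    \<open>z = 1\<close> gives \<open>t = 2\<close>.\<close>
  have c2: "CL_polytope P \<longleftrightarrow> V \<le> 4" "N = 2 * V + 1" if d: "CARD('n) = 2"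
  proof -
    have c: "coeff L 2 = V" "coeff L 1 = V"
      using Lm1 L(2) L0 unfolding poly_L d sum_atMost_numeral by simp_all
    show "N = 2 * V + 1"
      using L(5) c L0 unfolding poly_L d sum_atMost_numeral by simp
    have "(\<Sum>i\<le>2. of_real (coeff L i) * z ^ i) = of_real V * (z * (z + 1)) + 1" for z :: complex
      unfolding sum_atMost_numeral c L0 by (simp add: eval_nat_numeral field_simps)
    then show "CL_polytope P \<longleftrightarrow> V \<le> 4"
      unfolding CL d
      using ball_Re_eq_minus_half_iff[of "\<lambda>t. of_real V * t + 1 = 0"] linear_roots_le_iff[OF L(3)] by simp
  qed
  \<comment> \<open>Here \<open>L = (2 * z + 1) * (V / 2 * t + 1)\<close>; the first factor has its
    root on the line, which leaves \<open>V / 2 \<le> 4\<close>.\<close>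
  have c3: "CL_polytope P \<longleftrightarrow> V \<le> 8" "N = 3 * V + 3" if d: "CARD('n) = 3"
  proof -
    have c: "coeff L 3 = V" "coeff L 2 = 3 / 2 * V" "coeff L 1 = 2 + V / 2" and N: "N = 3 * V + 3"
      using Lm1 Lm2 Lhalf L(2,5) L0 unfolding poly_L d sum_atMost_numeral by simp_all
    show "N = 3 * V + 3" by (rule N)
    have "(\<Sum>i\<le>3. of_real (coeff L i) * z ^ i) = (2 * z + 1) * (of_real (V / 2) * (z * (z + 1)) + 1)" for z :: complex
      unfolding sum_atMost_numeral c L0 by (simp add: eval_nat_numeral field_simps)
    moreover have "Re z = - 1 / 2" if "2 * z + 1 = 0" for z
      using that by (simp add: complex_eq_iff)
    ultimately show "CL_polytope P \<longleftrightarrow> V \<le> 8"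
      unfolding CL d
      using ball_Re_eq_minus_half_iff[of "\<lambda>t. of_real (V / 2) * t + 1 = 0"] linear_roots_le_iff[of "V / 2"] L(3) by auto
  qed
  \<comment> \<open>If \<open>a = 2 * b\<close>, the other two inequalities read
    \<open>b \<le> 8\<close> and \<open>b \<ge> 8\<close>. This single boundary point is the
    exceptional case in dimensions four and five.\<close>
  have quad: "(a \<le> 2 * b \<and> 4 * b \<le> a + 16 \<and> b\<^sup>2 \<ge> 4 * a) \<longleftrightarrow>
      (a = 16 \<and> b = 8) \<or> (a < 2 * b \<and> 4 * b \<le> a + 16 \<and> b\<^sup>2 \<ge> 4 * a)" if "a > 0" for a b :: real
  proof (cases "a = 2 * b")
    case True
    then have "4 * b \<le> a + 16 \<and> b\<^sup>2 \<ge> 4 * a \<longleftrightarrow> b = 8"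
      using that by (auto simp: power2_eq_square)
    then show ?thesis using True by auto
  qed auto
  have c4: "CL_polytope P \<longleftrightarrow> (V = 16 \<and> N = 81) \<or>
      (5 * V < N - 1 \<and> 2 * N \<le> 9 * (V + 2) \<and> (N - 1 - 4 * V)\<^sup>2 \<ge> 16 * V)" if d: "CARD('n) = 4"
  proof -
    \<comment> \<open>The coefficient of \<open>t\<close> in \<open>L = V * t^2 + b * t + 1\<close>,
      read off from \<open>L\<close> at \<open>z = 1\<close>, where \<open>t = 2\<close>.\<close>
    define b where "b = (N - 1 - 4 * V) / 2"
    have N: "N = 4 * V + 2 * b + 1" by (simp add: b_def field_simps)
    have c: "coeff L 4 = V" "coeff L 3 = 2 * V" "coeff L 2 = V + b" "coeff L 1 = b"
      using Lm1 Lm2 Lhalf L(2,5) L0 unfolding poly_L d sum_atMost_numeral N by (simp_all add: field_simps)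
    have "(\<Sum>i\<le>4. of_real (coeff L i) * z ^ i) = of_real V * (z * (z + 1))\<^sup>2 + of_real b * (z * (z + 1)) + 1" for z :: complex
      unfolding sum_atMost_numeral c L0 by (simp add: eval_nat_numeral field_simps)
    then have "CL_polytope P \<longleftrightarrow> V \<le> 2 * b \<and> 4 * b \<le> V + 16 \<and> b\<^sup>2 \<ge> 4 * V"
      unfolding CL d
      using ball_Re_eq_minus_half_iff[of "\<lambda>t. of_real V * t\<^sup>2 + of_real b * t + 1 = 0"] quadratic_roots_le_iff[OF L(3), of b] by simp
    also have "\<dots> \<longleftrightarrow> (V = 16 \<and> N = 81) \<or>
      (5 * V < N - 1 \<and> 2 * N \<le> 9 * (V + 2) \<and> (N - 1 - 4 * V)\<^sup>2 \<ge> 16 * V)"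
      unfolding quad[OF L(3)] by (auto simp: N power2_eq_square)
    finally show ?thesis .
  qed
  have c5: "CL_polytope P \<longleftrightarrow> (V = 32 \<and> N = 243) \<or>
      (15 * V < 2 * (N - 3) \<and> 4 * N \<le> 27 * (V + 4) \<and> (N - 3 - 6 * V)\<^sup>2 \<ge> 72 * V)" if d: "CARD('n) = 5"
  proof -
    \<comment> \<open>Coefficients in \<open>L = (2 * z + 1) * (a * t^2 + b * t + 1)\<close>: the
      leading one is \<open>2 * a\<close>, and \<open>z = 1\<close> gives
      \<open>N = 3 * (4 * a + 2 * b + 1)\<close>.\<close>
    define a where "a = V / 2"
    define b where "b = (N - 3 - 6 * V) / 6"
    have V: "V = 2 * a" and N: "N = 12 * a + 6 * b + 3" by (simp_all add: a_def b_def field_simps)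
    have a: "a > 0" using L(3) by (simp add: a_def)
    have c: "coeff L 5 = 2 * a" "coeff L 4 = 5 * a" "coeff L 3 = 4 * a + 2 * b" "coeff L 2 = a + 3 * b" "coeff L 1 = 2 + b"
      using Lm1 Lm2 Lhalf L(2,5) L0 unfolding poly_L d sum_atMost_numeral N V by (simp_all add: field_simps)
    have "(\<Sum>i\<le>5. of_real (coeff L i) * z ^ i) =
        (2 * z + 1) * (of_real a * (z * (z + 1))\<^sup>2 + of_real b * (z * (z + 1)) + 1)" for z :: complex
      unfolding sum_atMost_numeral c L0 by (simp add: eval_nat_numeral field_simps)
    moreover have "Re z = - 1 / 2" if "2 * z + 1 = 0" for z
      using that by (simp add: complex_eq_iff)
    ultimately have "CL_polytope P \<longleftrightarrow> a \<le> 2 * b \<and> 4 * b \<le> a + 16 \<and> b\<^sup>2 \<ge> 4 * a"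
      unfolding CL d
      using ball_Re_eq_minus_half_iff[of "\<lambda>t. of_real a * t\<^sup>2 + of_real b * t + 1 = 0"] quadratic_roots_le_iff[OF a, of b] by auto
    also have "\<dots> \<longleftrightarrow> (V = 32 \<and> N = 243) \<or>
      (15 * V < 2 * (N - 3) \<and> 4 * N \<le> 27 * (V + 4) \<and> (N - 3 - 6 * V)\<^sup>2 \<ge> 72 * V)"
      unfolding quad[OF a] by (auto simp: N V power2_eq_square)
    finally show ?thesis .
  qed
  \<comment> \<open>In dimensions two and three \<open>N\<close> is an increasing affine function of
    \<open>V\<close>, which translates the volume bounds into point counts.\<close>
  show ?thesis
    using c2 c3 c4 c5 by auto
qed

end
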